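(* Let $\alpha>0$ and let $\{\Theta_t,t\ge1\}$ be a sequence of positive random variables satisfying the following condition, depending on the value of $\alpha$: - (RW1) if $0<\alpha<1$: for some $\epsilon\in(0,\alpha)$, $\sum_{t=1}^\infty E[\Theta_t^{\alpha+\epsilon}+\Theta_t^{\alpha-\epsilon}]<\infty$; - (RW2) if $1\le\alpha<\infty$: for some $\epsilon\in(0,\alpha)$, $\sum_{t=1}^\infty\left(E[\Theta_t^{\alpha+\epsilon}+\Theta_t^{\alpha-\epsilon}]\right)^{\frac1{\alpha+\epsilon}}<\infty$. Suppose that $\sum_{t=1}^\infty E[\Theta_t^{\alpha+i\beta_0}]=0$ for some $\beta_0\in\mathbb R$. Then there exists (on a possibly enlarged probability space) a sequence of i.i.d. positive random variables $\{X_t,t\ge1\}$, independent of $\{\Theta_t\}$, such that $X_1$ does not have a regularly varying tail, but $X_{(\infty)}=\sum_{t=1}^\infty\Theta_tX_t$ is finite almost surely and has regularly varying tail of index $-\alpha$.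
   Context: A random variable $X$ has regularly varying tail of index $-\alpha$ if $P[X>x]>0$ for all $x$ and $\lim_{x\to\infty}P[X>ux]/P[X>x]=u^{-\alpha}$ for every $u>0$; it has a regularly varying tail if this holds for some index. *)

theory Defs
  imports "HOL-Probability.Probability"
begin

text \<open>Sequences are indexed from 0: \<open>\<Theta> t\<close> and \<open>X t\<close> stand for the paper's
  \<open>\<Theta>\<^sub>t\<^sub>+\<^sub>1\<close> and \<open>X\<^sub>t\<^sub>+\<^sub>1\<close>.\<close>

definition positive_rv :: "'a measure \<Rightarrow> ('a \<Rightarrow> real) \<Rightarrow> bool" where
  "positive_rv M X \<longleftrightarrow> X \<in> borel_measurable M \<and> (AE \<omega> in M. 0 < X \<omega>)"

text \<open>The index is the exponent of the limit, so a tail decaying like \<open>x powr (- \<alpha>)\<close>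
  has index \<open>- \<alpha>\<close>.\<close>

definition regularly_varying_tail :: "'a measure \<Rightarrow> ('a \<Rightarrow> real) \<Rightarrow> real \<Rightarrow> bool" where
  "regularly_varying_tail M X \<rho> \<longleftrightarrow>
     (\<forall>x. measure M {\<omega> \<in> space M. X \<omega> > x} > 0) \<and>
     (\<forall>u>0. ((\<lambda>x. measure M {\<omega> \<in> space M. X \<omega> > u * x} / measure M {\<omega> \<in> space M. X \<omega> > x})
              \<longlongrightarrow> u powr \<rho>) at_top)"

definition has_regularly_varying_tail :: "'a measure \<Rightarrow> ('a \<Rightarrow> real) \<Rightarrow> bool" where
  "has_regularly_varying_tail M X \<longleftrightarrow> (\<exists>\<alpha>. regularly_varying_tail M X (- \<alpha>))"

text \<open>Finiteness of the series includes finiteness of each moment. It is stated as integrability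
  because the Bochner integral of a nonintegrable function is 0.\<close>

definition RW1 :: "'a measure \<Rightarrow> real \<Rightarrow> (nat \<Rightarrow> 'a \<Rightarrow> real) \<Rightarrow> bool" where
  "RW1 M \<alpha> \<Theta> \<longleftrightarrow> (\<exists>\<epsilon>. 0 < \<epsilon> \<and> \<epsilon> < \<alpha> \<and>
     (\<forall>t. integrable M (\<lambda>\<omega>. \<Theta> t \<omega> powr (\<alpha> + \<epsilon>) + \<Theta> t \<omega> powr (\<alpha> - \<epsilon>))) \<and>
     summable (\<lambda>t. \<integral>\<omega>. (\<Theta> t \<omega> powr (\<alpha> + \<epsilon>) + \<Theta> t \<omega> powr (\<alpha> - \<epsilon>)) \<partial>M))"

definition RW2 :: "'a measure \<Rightarrow> real \<Rightarrow> (nat \<Rightarrow> 'a \<Rightarrow> real) \<Rightarrow> bool" where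
  "RW2 M \<alpha> \<Theta> \<longleftrightarrow> (\<exists>\<epsilon>. 0 < \<epsilon> \<and> \<epsilon> < \<alpha> \<and>
     (\<forall>t. integrable M (\<lambda>\<omega>. \<Theta> t \<omega> powr (\<alpha> + \<epsilon>) + \<Theta> t \<omega> powr (\<alpha> - \<epsilon>))) \<and>
     summable (\<lambda>t. (\<integral>\<omega>. (\<Theta> t \<omega> powr (\<alpha> + \<epsilon>) + \<Theta> t \<omega> powr (\<alpha> - \<epsilon>)) \<partial>M)
                     powr (1 / (\<alpha> + \<epsilon>))))"

text \<open>\<open>N\<close> enlarges \<open>M\<close> via \<open>\<pi>\<close>; a random variable \<open>Y\<close> on \<open>M\<close> is identified with
  \<open>\<lambda>\<omega>. Y (\<pi> \<omega>)\<close> on \<open>N\<close>.\<close>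

definition enlarged_prob_space :: "'b measure \<Rightarrow> ('b \<Rightarrow> 'a) \<Rightarrow> 'a measure \<Rightarrow> bool" where
  "enlarged_prob_space N \<pi> M \<longleftrightarrow> prob_space N \<and> \<pi> \<in> measurable N M \<and> distr N M \<pi> = M"

definition iid :: "'a measure \<Rightarrow> (nat \<Rightarrow> 'a \<Rightarrow> real) \<Rightarrow> bool" where
  "iid N X \<longleftrightarrow> prob_space.indep_vars N (\<lambda>_. borel) X UNIV \<and>
     (\<forall>t. distr N borel (X t) = distr N borel (X 0))"

definition indep_sequences ::
    "'a measure \<Rightarrow> (nat \<Rightarrow> 'a \<Rightarrow> real) \<Rightarrow> (nat \<Rightarrow> 'a \<Rightarrow> real) \<Rightarrow> bool" where
  "indep_sequences N X Y \<longleftrightarrow>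
     prob_space.indep_var N (\<Pi>\<^sub>M t\<in>UNIV. borel) (\<lambda>\<omega> t. X t \<omega>) (\<Pi>\<^sub>M t\<in>UNIV. borel) (\<lambda>\<omega> t. Y t \<omega>)"

end

theory Submission
  imports Defs
begin

text \<open>
  The idea is to perturb a Pareto tail by an oscillation on the logarithmic scale whose frequency is
  the zero \<open>\<beta>\<^sub>0\<close> of the series of complex moments. With \<open>b = \<bar>\<beta>\<^sub>0\<bar>\<close>, let \<open>X\<close> have on \<open>[1, \<infinity>)\<close> the
  tail \<open>x\<^sup>-\<^sup>\<alpha> (1 + a cos (b ln x)) / (1 + a)\<close>, which is decreasing for small \<open>a > 0\<close>. The oscillation never
  dies out, so this tail is not regularly varying. For a positive weight \<open>\<Theta>\<close> independent of \<open>X\<close>, the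
  tail of \<open>\<Theta> X\<close> is approximately \<open>x\<^sup>-\<^sup>\<alpha>\<close> times
  \<open>(E[\<Theta>\<^sup>\<alpha>] + a Re (exp (-i \<beta>\<^sub>0 ln x) E[\<Theta> powr (\<alpha> + i \<beta>\<^sub>0)])) / (1 + a)\<close>.
  Summing over the weights, the oscillating parts cancel by hypothesis, and what remains is
  a constant multiple of \<open>x\<^sup>-\<^sup>\<alpha>\<close>. The hypothesis also forces \<open>\<beta>\<^sub>0 \<noteq> 0\<close>, since for \<open>\<beta>\<^sub>0 = 0\<close> it would say
  that a series of positive terms vanishes.

  It remains to see that the tail of the series is asymptotically the sum of the tails of its terms.
  This is first shown for deterministic weights (\<open>one_big_jump\<close>): a large value of the series is
  produced by a single large term, because two large terms have probability \<open>O(x\<^sup>-\<^sup>2\<^sup>\<alpha>)\<close>. The law of \<open>X\<close>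
  enters only through three estimates collected in the locale \<open>dominated_tail_law\<close>,
  which oscillating tails can satisfy as well. Random weights are then handled by conditioning on them and by dominated
  convergence (\<open>weighted_sum_tail_asymptotics\<close>). The dominating function comes from a tail bound that is
  linear in the numbers \<open>\<Theta>\<^sub>t\<^sup>\<alpha>\<close> (\<open>weighted_series_tail_le\<close>). Such a bound is available because Jensen's
  inequality with fixed weights \<open>w\<^sub>t\<close> separates the terms of the series: the sum then costs the
  factors \<open>w\<^sub>t powr (1 - q)\<close>, where \<open>q = 1\<close> if \<open>\<alpha> < 1\<close> and \<open>q = \<alpha> + \<epsilon>\<close> otherwise, and the choice of \<open>w\<^sub>t\<close>
  proportional to \<open>E[\<Theta>\<^sub>t\<^sup>\<alpha>] powr (1 / q)\<close> turns the summability of \<open>\<Sum> w\<^sub>t powr (1 - q) E[\<Theta>\<^sub>t\<^sup>\<alpha>]\<close>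
  into a consequence of the moment condition.
\<close>

section \<open>Inequalities for sums and unions\<close>

text \<open>Jensen's inequality for the convex combination of the numbers \<open>W * y i / w i\<close> with weights
  \<open>w i / W\<close>, where \<open>W = sum w I\<close>; the remaining factor \<open>W powr (q - 1)\<close> is at most 1. It replaces
  Minkowski's inequality in the form of a bound that is linear in the numbers \<open>y i powr q\<close>, so that
  expectations can be taken term by term.\<close>

lemma powr_sum_le_weighted_sum_powr:
  fixes w y :: "'i \<Rightarrow> real"
  assumes "finite I" and w: "\<And>i. i \<in> I \<Longrightarrow> 0 < w i" "sum w I \<le> 1"
    and y: "\<And>i. i \<in> I \<Longrightarrow> 0 < y i" and q: "1 \<le> q"
  shows "(\<Sum>i\<in>I. y i) powr q \<le> (\<Sum>i\<in>I. w i powr (1 - q) * y i powr q)"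
proof (cases "I = {}")
  case False
  define W where "W = sum w I"
  have W: "0 < W" "W \<le> 1" using False assms by (auto simp: W_def intro: sum_pos)
  have "(\<Sum>i\<in>I. y i) = (\<Sum>i\<in>I. (w i / W) *\<^sub>R (W * y i / w i))"
    using W w by (intro sum.cong) (auto simp: less_imp_neq[THEN not_sym])
  also have "\<dots> powr q \<le> (\<Sum>i\<in>I. (w i / W) * (W * y i / w i) powr q)"
  proof (rule convex_on_sum[OF \<open>finite I\<close> False powr_convex[OF q]])
    show "(\<Sum>i\<in>I. w i / W) = 1" using W by (simp add: W_def flip: sum_divide_distrib)
  qed (use W w y in \<open>auto intro!: divide_pos_pos mult_pos_pos divide_nonneg_nonneg less_imp_le[OF w(1)]\<close>)
  also have "\<dots> \<le> (\<Sum>i\<in>I. w i powr (1 - q) * y i powr q)"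
  proof (rule sum_mono)
    fix i assume i: "i \<in> I"
    have "(w i / W) * (W * y i / w i) powr q = W powr (q - 1) * (w i powr (1 - q) * y i powr q)"
      using W w(1)[OF i] y[OF i] by (simp add: powr_mult powr_divide powr_diff field_simps)
    also have "\<dots> \<le> 1 * (w i powr (1 - q) * y i powr q)"
      using W q by (intro mult_right_mono powr_le1) auto
    finally show "(w i / W) * (W * y i / w i) powr q \<le> w i powr (1 - q) * y i powr q" by simp
  qed
  finally show ?thesis .
qed simp

lemma sum_weights_le_1:
  fixes w :: "nat \<Rightarrow> real"
  assumes "\<And>t. 0 < w t" "w sums 1" "finite I"
  shows "sum w I \<le> 1"
  using sum_le_suminf[of w I] assms by (auto simp: sums_iff less_imp_le)

lemma weight_powr_ge_1:
  fixes w :: "nat \<Rightarrow> real"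
  assumes "\<And>t. 0 < w t" "w sums 1" "1 \<le> q"
  shows "1 \<le> w t powr (1 - q)"
  using powr_mono'[of "1 - q" 0 "w t"] sum_weights_le_1[of w "{t}"] assms(1)[of t] assms(2,3)
    assms(1) by simp

text \<open>The second Bonferroni inequality.\<close>

lemma (in finite_measure) sum_measure_le_measure_UN_plus_pairs:
  fixes n :: nat
  assumes "\<And>t. A t \<in> sets M"
  shows "(\<Sum>t<n. measure M (A t)) \<le>
    measure M (\<Union>t<n. A t) + (\<Sum>t<n. \<Sum>s<t. measure M (A s \<inter> A t))"
proof (induction n)
  case (Suc n)
  have [measurable]: "A t \<in> sets M" for t by fact
  have "(\<Union>t<Suc n. A t) = (\<Union>t<n. A t) \<union> A n" by (auto simp: lessThan_Suc)
  hence "measure M (\<Union>t<Suc n. A t) =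
      measure M (\<Union>t<n. A t) + measure M (A n) - measure M ((\<Union>t<n. A t) \<inter> A n)"
    by (simp add: measure_Un3 fmeasurable_eq_sets)
  moreover have "measure M ((\<Union>t<n. A t) \<inter> A n) \<le> (\<Sum>s<n. measure M (A s \<inter> A n))"
  proof -
    have "(\<Union>t<n. A t) \<inter> A n = (\<Union>t<n. A t \<inter> A n)" by auto
    thus ?thesis
      by (simp only:) (rule finite_measure_subadditive_finite, auto)
  qed
  ultimately show ?case using Suc.IH by simp
qed simp

text \<open>The deterministic core of the single big jump. If at most one of the first \<open>n\<close> terms is larger than
  \<open>d * x\<close>, then the others add up to at most \<open>n * (d * x) \<le> (1 - u) / 2 * x\<close>; hence the exceptional
  term must be larger than \<open>u * x\<close> unless the terms from \<open>n\<close> on contribute another \<open>(1 - u) / 2 * x\<close>.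
  The denominator of \<open>d\<close> contains \<open>n + 1\<close> in order to cover \<open>n = 0\<close>.\<close>

lemma sum_exceeds_cases:
  fixes y :: "nat \<Rightarrow> real" and n :: nat
  assumes x: "0 < x" and u: "0 < u" "u < 1" and y: "\<And>t. 0 \<le> y t"
    and exceeds: "x < (\<Sum>t<m. y t)"
  defines "d \<equiv> (1 - u) / (2 * (real n + 1))"
  shows "(\<exists>t<n. u * x < y t) \<or> (\<exists>t<n. \<exists>s<t. d * x < y s \<and> d * x < y t) \<or>
    (\<exists>m. (1 - u) / 2 * x < (\<Sum>t\<in>{n..<m}. y t))"
proof (rule ccontr)
  assume neg: "\<not> ?thesis"
  define m' where "m' = max m n"
  have d: "0 < d" "(real n + 1) * d = (1 - u) / 2"
    using u by (auto simp: d_def field_simps)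
  have nd: "real n * (d * x) \<le> (1 - u) / 2 * x"
  proof -
    have "real n * (d * x) \<le> (real n + 1) * (d * x)"
      using d x by (intro mult_right_mono) auto
    also have "\<dots> = (1 - u) / 2 * x" using d by (simp flip: mult.assoc)
    finally show ?thesis .
  qed
  have "(\<Sum>t<n. y t) \<le> u * x + (1 - u) / 2 * x"
  proof (cases "\<exists>t<n. d * x < y t")
    case False
    hence "(\<Sum>t<n. y t) \<le> real (card {..<n}) * (d * x)"
      by (intro sum_bounded_above) (meson lessThan_iff not_less)
    moreover have "0 < u * x" using u x by simp
    ultimately show ?thesis using nd by (simp only: card_lessThan)
  next
    case True
    then obtain t where t: "t < n" "d * x < y t" by blast
    have "y s \<le> d * x" if "s < n" "s \<noteq> t" for s
      using neg t that by (meson linorder_neqE_nat not_less)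
    hence "sum y ({..<n} - {t}) \<le> real (card ({..<n} - {t})) * (d * x)"
      by (intro sum_bounded_above) auto
    also have "\<dots> \<le> real n * (d * x)"
      using t d x by (intro mult_right_mono) auto
    finally have "sum y ({..<n} - {t}) \<le> (1 - u) / 2 * x" using nd by simp
    moreover have "y t \<le> u * x" using neg t(1) by (meson not_less)
    moreover have "(\<Sum>t<n. y t) = y t + sum y ({..<n} - {t})"
      using t by (intro sum.remove) auto
    ultimately show ?thesis by simp
  qed
  moreover have "(\<Sum>t\<in>{n..<m'}. y t) \<le> (1 - u) / 2 * x"
    using neg by (auto simp: not_less)
  moreover have "(\<Sum>t<m'. y t) = (\<Sum>t<n. y t) + (\<Sum>t\<in>{n..<m'}. y t)"
    by (simp add: m'_def sum.atLeastLessThan_concat atLeast0LessThan[symmetric])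
  moreover have "(\<Sum>t<m. y t) \<le> (\<Sum>t<m'. y t)"
    using y by (intro sum_mono2) (auto simp: m'_def)
  moreover have "u * x + (1 - u) / 2 * x + (1 - u) / 2 * x = x"
    by (simp add: field_simps)
  ultimately show False using exceeds by linarith
qed

section \<open>Sums with fixed weights: the single big jump\<close>

text \<open>What the limit theorem uses of the law of the summands: the tail is at most a Pareto tail, it grows
  at most polynomially under contraction of the argument (so that a contraction by a factor near 1
  changes it by a factor near 1), and the truncated moments of order \<open>q > \<alpha>\<close> have the order of
  magnitude of Pareto moments.\<close>

locale dominated_tail_law = D: prob_space D for D :: "real measure" +
  fixes \<alpha> \<kappa> q K :: real
  assumes sets_D [simp, measurable_cong]: "sets D = sets borel"
    and alpha_pos: "0 < \<alpha>" and q_ge_1: "1 \<le> q" and alpha_less_q: "\<alpha> < q" and K_nonneg: "0 \<le> K"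
    and AE_D_pos: "AE x in D. 0 < x"
    and tail_le: "\<And>x. 0 < x \<Longrightarrow> measure D {x<..} \<le> x powr (-\<alpha>)"
    and tail_dilate: "\<And>u x. 0 < u \<Longrightarrow> u \<le> 1 \<Longrightarrow> 0 < x \<Longrightarrow>
      measure D {u * x<..} \<le> u powr (-\<kappa>) * measure D {x<..}"
    and truncated_moment_le: "\<And>x. 0 < x \<Longrightarrow>
      (\<integral>\<^sup>+ y. ennreal (y powr q * indicator {..x} y) \<partial>D) \<le> ennreal (K * x powr (q - \<alpha>))"
begin

abbreviation P :: "(nat \<Rightarrow> real) measure" where
  "P \<equiv> PiM UNIV (\<lambda>_. D)"

sublocale P: product_prob_space "\<lambda>_::nat. D" UNIV
  by unfold_locales

lemma space_D [simp]: "space D = UNIV"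
  using sets_eq_imp_space_eq[OF sets_D] by simp

lemma space_P [simp]: "space P = UNIV"
  by (simp add: space_PiM PiE_def)

lemma AE_P_pos: "AE \<omega> in P. \<forall>t. 0 < \<omega> t"
  unfolding AE_all_countable using AE_D_pos by (intro allI P.AE_component) auto

lemma coordinate_tail:
  assumes "0 < \<theta>"
  shows "measure P {\<omega>. x < \<theta> * \<omega> t} = measure D {x / \<theta><..}"
proof -
  have "{\<omega>. x < \<theta> * \<omega> t} = {\<omega> \<in> space P. \<omega> t \<in> {x / \<theta><..}}"
    using assms by (auto simp: field_simps)
  thus ?thesis
    using P.emeasure_PiM_Collect_single[of t "{x / \<theta><..}"] by (simp add: measure_def)
qed

text \<open>By independence two coordinates are simultaneously large with probability of squared order. This is
  what makes a second big jump negligible.\<close>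

lemma coordinate_pair_tail_le:
  assumes "0 < \<theta>" "0 < \<theta>'" "s \<noteq> t" "0 < x"
  shows "measure P {\<omega>. x < \<theta> * \<omega> s \<and> x < \<theta>' * \<omega> t} \<le> x powr (-(2 * \<alpha>)) * (\<theta> powr \<alpha> * \<theta>' powr \<alpha>)"
proof -
  let ?A = "\<lambda>i. if i = s then {x / \<theta><..} else {x / \<theta>'<..}"
  have "{\<omega>. x < \<theta> * \<omega> s \<and> x < \<theta>' * \<omega> t} = {\<omega> \<in> space P. \<forall>i\<in>{s,t}. \<omega> i \<in> ?A i}"
    using assms by (auto simp: field_simps)
  hence "emeasure P {\<omega>. x < \<theta> * \<omega> s \<and> x < \<theta>' * \<omega> t} = emeasure D {x / \<theta><..} * emeasure D {x / \<theta>'<..}"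
    using P.emeasure_PiM_Collect[of "{s,t}" ?A] \<open>s \<noteq> t\<close> by simp
  hence "measure P {\<omega>. x < \<theta> * \<omega> s \<and> x < \<theta>' * \<omega> t} = measure D {x / \<theta><..} * measure D {x / \<theta>'<..}"
    by (simp add: measure_def enn2real_mult)
  also have "\<dots> \<le> (x / \<theta>) powr (-\<alpha>) * (x / \<theta>') powr (-\<alpha>)"
    using assms by (intro mult_mono tail_le) auto
  also have "\<dots> = x powr (-(2 * \<alpha>)) * (\<theta> powr \<alpha> * \<theta>' powr \<alpha>)"
  proof -
    have "x powr (-(2 * \<alpha>)) = x powr (-\<alpha>) * x powr (-\<alpha>)" by (simp flip: powr_add)
    thus ?thesis using assms by (simp add: powr_divide powr_minus field_simps)
  qed
  finally show ?thesis .
qed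

text \<open>If the sum exceeds \<open>x\<close>, then either one term does, or all terms are at most \<open>x\<close> and the \<open>q\<close>-th power of
  the sum of the truncated terms exceeds \<open>x powr q\<close>. The first case is covered by the union bound,
  the second by Markov's inequality after Jensen's inequality. The function \<open>\<phi> t\<close> majorizes the
  contribution of the coordinate \<open>t\<close> in both cases.\<close>

lemma finite_weighted_sum_tail_le:
  fixes I :: "nat set"
  assumes I: "finite I" and \<theta>: "\<And>t. 0 < \<theta> t" and w: "\<And>t. 0 < w t" "sum w I \<le> 1" and x: "0 < x"
  shows "measure P {\<omega>. x < (\<Sum>t\<in>I. \<theta> t * \<omega> t)} \<le>
    (1 + K) * x powr (-\<alpha>) * (\<Sum>t\<in>I. w t powr (1 - q) * \<theta> t powr \<alpha>)"
proof -
  define c where "c t = x powr (-q) * (w t powr (1 - q) * \<theta> t powr q)" for t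
  define \<phi> where "\<phi> t y = indicator {x / \<theta> t<..} y + ennreal (c t) * ennreal (y powr q * indicator {..x / \<theta> t} y)"
    for t y
  have c_nonneg: "0 \<le> c t" for t by (simp add: c_def)
  have [measurable]: "\<phi> t \<in> borel_measurable borel" for t unfolding \<phi>_def by measurable
  have w_le: "w t \<le> 1" if "t \<in> I" for t
    using member_le_sum[of t I w] that I w less_imp_le[OF w(1)] by auto
  have "emeasure P {\<omega>. x < (\<Sum>t\<in>I. \<theta> t * \<omega> t)} = (\<integral>\<^sup>+ \<omega>. indicator {\<omega>. x < (\<Sum>t\<in>I. \<theta> t * \<omega> t)} \<omega> \<partial>P)"
  proof (rule nn_integral_indicator[symmetric])
    have "{\<omega> \<in> space P. x < (\<Sum>t\<in>I. \<theta> t * \<omega> t)} \<in> sets P" by measurable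
    thus "{\<omega>. x < (\<Sum>t\<in>I. \<theta> t * \<omega> t)} \<in> sets P" by simp
  qed
  also have "\<dots> \<le> (\<integral>\<^sup>+ \<omega>. (\<Sum>t\<in>I. \<phi> t (\<omega> t)) \<partial>P)"
  proof (intro nn_integral_mono_AE, use AE_P_pos in eventually_elim)
    fix \<omega> :: "nat \<Rightarrow> real" assume \<omega>: "\<forall>t. 0 < \<omega> t"
    show "indicator {\<omega>. x < (\<Sum>t\<in>I. \<theta> t * \<omega> t)} \<omega> \<le> (\<Sum>t\<in>I. \<phi> t (\<omega> t))"
    proof (cases "x < (\<Sum>t\<in>I. \<theta> t * \<omega> t)")
      case exceeds: True
      show ?thesis
      proof (cases "\<exists>t\<in>I. x < \<theta> t * \<omega> t")
        case True
        then obtain t where t: "t \<in> I" "x < \<theta> t * \<omega> t" by blast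
        have "1 = indicator {x / \<theta> t<..} (\<omega> t)"
          using t \<theta>[of t] by (simp add: indicator_def field_simps)
        also have "\<dots> \<le> \<phi> t (\<omega> t)" by (simp add: \<phi>_def)
        also have "\<dots> \<le> (\<Sum>t\<in>I. \<phi> t (\<omega> t))" using I t by (intro member_le_sum) auto
        finally show ?thesis using exceeds by simp
      next
        case False
        have "x powr q \<le> (\<Sum>t\<in>I. \<theta> t * \<omega> t) powr q"
          using exceeds x q_ge_1 by (intro powr_mono2) auto
        also have "\<dots> \<le> (\<Sum>t\<in>I. w t powr (1 - q) * (\<theta> t * \<omega> t) powr q)"
          using I w \<theta> \<omega> q_ge_1
          by (intro powr_sum_le_weighted_sum_powr) auto
        finally have "x powr (-q) * x powr q \<le> x powr (-q) * (\<Sum>t\<in>I. w t powr (1 - q) * (\<theta> t * \<omega> t) powr q)"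
          by (intro mult_left_mono) auto
        hence "1 \<le> (\<Sum>t\<in>I. c t * (\<omega> t powr q))"
          using x \<theta> \<omega> by (simp add: powr_minus sum_distrib_left c_def powr_mult less_imp_le mult.assoc)
        hence "1 \<le> (\<Sum>t\<in>I. ennreal (c t * (\<omega> t powr q)))"
          by (subst sum_ennreal) (auto simp: c_nonneg)
        also have "\<dots> \<le> (\<Sum>t\<in>I. \<phi> t (\<omega> t))"
        proof (intro sum_mono)
          fix t assume "t \<in> I"
          hence "\<omega> t \<le> x / \<theta> t" using False \<theta>[of t] by (auto simp: field_simps not_less)
          thus "ennreal (c t * (\<omega> t powr q)) \<le> \<phi> t (\<omega> t)"
            using c_nonneg by (auto simp: \<phi>_def ennreal_mult)
        qed
        finally show ?thesis using exceeds by simp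
      qed
    qed simp
  qed
  also have "\<dots> = (\<Sum>t\<in>I. \<integral>\<^sup>+ \<omega>. \<phi> t (\<omega> t) \<partial>P)"
    by (intro nn_integral_sum) measurable
  also have "\<dots> = (\<Sum>t\<in>I. \<integral>\<^sup>+ y. \<phi> t y \<partial>D)"
  proof (intro sum.cong refl)
    fix t
    have "(\<integral>\<^sup>+ \<omega>. \<phi> t (\<omega> t) \<partial>P) = (\<integral>\<^sup>+ y. \<phi> t y \<partial>distr P D (\<lambda>\<omega>. \<omega> t))"
      by (subst nn_integral_distr) auto
    thus "(\<integral>\<^sup>+ \<omega>. \<phi> t (\<omega> t) \<partial>P) = (\<integral>\<^sup>+ y. \<phi> t y \<partial>D)" by (simp add: P.PiM_component)
  qed
  also have "\<dots> \<le> (\<Sum>t\<in>I. ennreal ((1 + K) * x powr (-\<alpha>) * (w t powr (1 - q) * \<theta> t powr \<alpha>)))"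
  proof (rule sum_mono)
    fix t assume t: "t \<in> I"
    have xt: "0 < x / \<theta> t" using x \<theta> by simp
    have "(\<integral>\<^sup>+ y. \<phi> t y \<partial>D) = emeasure D {x / \<theta> t<..} +
        ennreal (c t) * (\<integral>\<^sup>+ y. ennreal (y powr q * indicator {..x / \<theta> t} y) \<partial>D)"
      unfolding \<phi>_def by (subst nn_integral_add) (auto simp: nn_integral_cmult)
    also have "\<dots> \<le> ennreal ((x / \<theta> t) powr (-\<alpha>)) + ennreal (c t) * ennreal (K * (x / \<theta> t) powr (q - \<alpha>))"
      using tail_le[OF xt] truncated_moment_le[OF xt]
      by (intro add_mono mult_left_mono) (auto simp: D.emeasure_eq_measure)
    also have "\<dots> = ennreal ((x / \<theta> t) powr (-\<alpha>) + c t * (K * (x / \<theta> t) powr (q - \<alpha>)))"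
      using c_nonneg K_nonneg by (simp add: ennreal_mult ennreal_plus)
    also have "(x / \<theta> t) powr (-\<alpha>) + c t * (K * (x / \<theta> t) powr (q - \<alpha>)) =
        x powr (-\<alpha>) * \<theta> t powr \<alpha> * 1 + K * x powr (-\<alpha>) * \<theta> t powr \<alpha> * w t powr (1 - q)"
      using x \<theta>[of t] by (simp add: c_def powr_divide powr_minus powr_diff field_simps)
    also have "\<dots> \<le> x powr (-\<alpha>) * \<theta> t powr \<alpha> * w t powr (1 - q) + K * x powr (-\<alpha>) * \<theta> t powr \<alpha> * w t powr (1 - q)"
      using powr_mono'[of "1 - q" 0 "w t"] w_le[OF t] w(1)[of t] q_ge_1
      by (intro add_right_mono mult_left_mono) auto
    also have "\<dots> = (1 + K) * x powr (-\<alpha>) * (w t powr (1 - q) * \<theta> t powr \<alpha>)"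
      by (simp add: algebra_simps)
    finally show "(\<integral>\<^sup>+ y. \<phi> t y \<partial>D) \<le> ennreal ((1 + K) * x powr (-\<alpha>) * (w t powr (1 - q) * \<theta> t powr \<alpha>))"
      by (simp add: ennreal_leI)
  qed
  also have "\<dots> = ennreal ((1 + K) * x powr (-\<alpha>) * (\<Sum>t\<in>I. w t powr (1 - q) * \<theta> t powr \<alpha>))"
    using K_nonneg by (subst sum_ennreal) (auto simp: sum_distrib_left)
  finally show ?thesis
    using K_nonneg by (simp add: P.emeasure_eq_measure sum_nonneg)
qed

lemma exceeds_event_measurable [measurable]:
  "{\<omega>. \<exists>m. x < (\<Sum>t\<in>{n..<m}. \<theta> t * \<omega> t)} \<in> sets P" "{\<omega>. x < (\<Sum>t\<in>I. \<theta> t * \<omega> t)} \<in> sets P"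
  "{\<omega>. x < \<theta> t * \<omega> t} \<in> sets P"
proof -
  have "{\<omega>\<in>space P. \<exists>m. x < (\<Sum>t\<in>{n..<m}. \<theta> t * \<omega> t)} \<in> sets P"
    "{\<omega>\<in>space P. x < (\<Sum>t\<in>I. \<theta> t * \<omega> t)} \<in> sets P" "{\<omega>\<in>space P. x < \<theta> t * \<omega> t} \<in> sets P"
    by measurable
  thus "{\<omega>. \<exists>m. x < (\<Sum>t\<in>{n..<m}. \<theta> t * \<omega> t)} \<in> sets P"
    "{\<omega>. x < (\<Sum>t\<in>I. \<theta> t * \<omega> t)} \<in> sets P" "{\<omega>. x < \<theta> t * \<omega> t} \<in> sets P" by auto
qed

text \<open>Passage to the limit in the number of terms, which is monotone because the terms are positive.
  For \<open>n = 0\<close> this bound dominates the tail of the whole series; for large \<open>n\<close> it shows that the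
  remainder of the series is negligible uniformly on the scale \<open>x powr (-\<alpha>)\<close>.\<close>

lemma weighted_series_tail_le:
  assumes \<theta>: "\<And>t. 0 < \<theta> t" and w: "\<And>t. 0 < w t" "w sums 1" and x: "0 < x"
    and V: "summable (\<lambda>t. w t powr (1 - q) * \<theta> t powr \<alpha>)"
  shows "measure P {\<omega>. \<exists>m. x < (\<Sum>t\<in>{n..<m}. \<theta> t * \<omega> t)} \<le>
    (1 + K) * x powr (-\<alpha>) * (\<Sum>t. w (t + n) powr (1 - q) * \<theta> (t + n) powr \<alpha>)"
proof -
  define F where "F m = {\<omega>. x < (\<Sum>t\<in>{n..<m}. \<theta> t * \<omega> t)}" for m
  define G where "G m = (\<Union>k\<le>m. F k)" for m
  have [measurable]: "F m \<in> sets P" for m unfolding F_def by measurable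
  have [measurable]: "G m \<in> sets P" for m unfolding G_def by measurable
  have "incseq G" by (fastforce simp: incseq_def G_def)
  hence "(\<lambda>m. measure P (G m)) \<longlonglongrightarrow> measure P (\<Union>m. G m)"
    by (intro P.finite_Lim_measure_incseq) auto
  moreover have "measure P (G m) \<le>
      (1 + K) * x powr (-\<alpha>) * (\<Sum>t. w (t + n) powr (1 - q) * \<theta> (t + n) powr \<alpha>)" for m
  proof -
    have "measure P (G m) \<le> measure P (F m)"
    proof (intro P.finite_measure_mono_AE, use AE_P_pos in eventually_elim)
      fix \<omega> :: "nat \<Rightarrow> real" assume \<omega>: "\<forall>t. 0 < \<omega> t"
      have "(\<Sum>t\<in>{n..<k}. \<theta> t * \<omega> t) \<le> (\<Sum>t\<in>{n..<m}. \<theta> t * \<omega> t)" if "k \<le> m" for k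
        using that \<theta> \<omega> by (intro sum_mono2) (auto intro!: mult_nonneg_nonneg less_imp_le)
      thus "\<omega> \<in> G m \<longrightarrow> \<omega> \<in> F m" unfolding G_def F_def by force
    qed simp
    also have "\<dots> \<le> (1 + K) * x powr (-\<alpha>) * (\<Sum>t\<in>{n..<m}. w t powr (1 - q) * \<theta> t powr \<alpha>)"
      unfolding F_def using \<theta> w x by (intro finite_weighted_sum_tail_le sum_weights_le_1) auto
    also have "(\<Sum>t\<in>{n..<m}. w t powr (1 - q) * \<theta> t powr \<alpha>) =
        (\<Sum>t<m - n. w (t + n) powr (1 - q) * \<theta> (t + n) powr \<alpha>)"
      by (rule sum.reindex_bij_witness[of _ "\<lambda>t. t + n" "\<lambda>t. t - n"]) auto
    also have "\<dots> \<le> (\<Sum>t. w (t + n) powr (1 - q) * \<theta> (t + n) powr \<alpha>)"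
      using V by (intro sum_le_suminf) (auto simp: summable_iff_shift[of "\<lambda>t. w t powr (1 - q) * \<theta> t powr \<alpha>"])
    finally show ?thesis using K_nonneg by (simp add: mult_left_mono)
  qed
  ultimately have "measure P (\<Union>m. G m) \<le>
      (1 + K) * x powr (-\<alpha>) * (\<Sum>t. w (t + n) powr (1 - q) * \<theta> (t + n) powr \<alpha>)"
    by (intro LIMSEQ_le_const2) auto
  moreover have "(\<Union>m. G m) = {\<omega>. \<exists>m. x < (\<Sum>t\<in>{n..<m}. \<theta> t * \<omega> t)}"
    unfolding G_def F_def by auto
  ultimately show ?thesis by simp
qed

text \<open>The partial sums increase, and the tail bound lets the probability that they exceed a level tend to
  0 as the level tends to infinity.\<close>

lemma AE_weighted_series_summable:
  assumes \<theta>: "\<And>t. 0 < \<theta> t" and w: "\<And>t. 0 < w t" "w sums 1"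
    and V: "summable (\<lambda>t. w t powr (1 - q) * \<theta> t powr \<alpha>)"
  shows "AE \<omega> in P. summable (\<lambda>t. \<theta> t * \<omega> t)"
proof -
  let ?E = "\<lambda>x. {\<omega>. \<exists>m. x < (\<Sum>t\<in>{0..<m}. \<theta> t * \<omega> t)}"
  let ?V = "\<Sum>t. w t powr (1 - q) * \<theta> t powr \<alpha>"
  define N where "N = (\<Inter>k. ?E (real (Suc k)))"
  have [measurable]: "N \<in> sets P" unfolding N_def by measurable
  have "measure P N \<le> (1 + K) * real (Suc k) powr (-\<alpha>) * ?V" for k
  proof -
    have "measure P N \<le> measure P (?E (real (Suc k)))"
      by (intro P.finite_measure_mono) (auto simp: N_def)
    also have "\<dots> \<le> (1 + K) * real (Suc k) powr (-\<alpha>) * ?V"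
      using weighted_series_tail_le[OF \<theta> w _ V, of "real (Suc k)" 0] by simp
    finally show ?thesis .
  qed
  moreover have "(\<lambda>k. (1 + K) * real (Suc k) powr (-\<alpha>) * ?V) \<longlonglongrightarrow> (1 + K) * 0 * ?V"
    using alpha_pos by (intro tendsto_intros tendsto_neg_powr filterlim_compose[OF filterlim_real_sequentially filterlim_Suc]) auto
  ultimately have "measure P N \<le> 0" by (intro LIMSEQ_le_const) auto
  hence "emeasure P N = 0" by (simp add: P.emeasure_eq_measure measure_le_0_iff)
  hence "AE \<omega> in P. \<omega> \<notin> N" by (intro AE_not_in) (auto simp: null_sets_def)
  with AE_P_pos show ?thesis
  proof eventually_elim
    case (elim \<omega>)
    then obtain k where k: "\<And>m. (\<Sum>t\<in>{0..<m}. \<theta> t * \<omega> t) \<le> real (Suc k)"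
      unfolding N_def by (auto simp: not_less)
    have nn: "0 \<le> \<theta> t * \<omega> t" for t using elim \<theta>[of t] by (simp add: less_imp_le)
    show ?case
    proof (rule bounded_imp_summable[OF nn])
      show "(\<Sum>t\<le>m. \<theta> t * \<omega> t) \<le> real (Suc k)" for m
        using k[of "Suc m"] by (simp only: atLeast0LessThan lessThan_Suc_atMost)
    qed
  qed
qed

text \<open>The union bound for the three cases of \<open>sum_exceeds_cases\<close>.\<close>

lemma weighted_series_tail_upper:
  fixes n :: nat
  assumes \<theta>: "\<And>t. 0 < \<theta> t" and w: "\<And>t. 0 < w t" "w sums 1" and x: "0 < x"
    and V: "summable (\<lambda>t. w t powr (1 - q) * \<theta> t powr \<alpha>)"
    and u: "0 < u" "u < 1"
  defines "d \<equiv> (1 - u) / (2 * (real n + 1))"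
  shows "measure P {\<omega>. \<exists>m. x < (\<Sum>t<m. \<theta> t * \<omega> t)} \<le>
    (\<Sum>t<n. measure D {u * x / \<theta> t<..}) +
    (d * x) powr (-(2 * \<alpha>)) * (\<Sum>t<n. \<Sum>s<t. \<theta> s powr \<alpha> * \<theta> t powr \<alpha>) +
    (1 + K) * ((1 - u) / 2 * x) powr (-\<alpha>) * (\<Sum>t. w (t + n) powr (1 - q) * \<theta> (t + n) powr \<alpha>)"
    (is "measure P ?E \<le> ?S + ?Q + ?R")
proof -
  define A where "A t = {\<omega>. u * x < \<theta> t * \<omega> t}" for t
  define B where "B s t = {\<omega>. d * x < \<theta> s * \<omega> s \<and> d * x < \<theta> t * \<omega> t}" for s t
  define C where "C = {\<omega>. \<exists>m. (1 - u) / 2 * x < (\<Sum>t\<in>{n..<m}. \<theta> t * \<omega> t)}"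
  have d: "0 < d" using u by (auto simp: d_def)
  have [measurable]: "A t \<in> sets P" "C \<in> sets P" for t unfolding A_def C_def by measurable
  have [measurable]: "B s t \<in> sets P" for s t
    unfolding B_def Collect_conj_eq by measurable
  have sub: "AE \<omega> in P. \<omega> \<in> ?E \<longrightarrow> \<omega> \<in> ((\<Union>t<n. A t) \<union> (\<Union>t<n. \<Union>s<t. B s t)) \<union> C"
    using AE_P_pos
  proof eventually_elim
    case (elim \<omega>)
    show ?case
    proof
      assume "\<omega> \<in> ?E"
      then obtain m where m: "x < (\<Sum>t<m. \<theta> t * \<omega> t)" by auto
      have nn: "0 \<le> \<theta> t * \<omega> t" for t using elim \<theta>[of t] by (simp add: less_imp_le)
      show "\<omega> \<in> ((\<Union>t<n. A t) \<union> (\<Union>t<n. \<Union>s<t. B s t)) \<union> C"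
        using sum_exceeds_cases[where n = n, OF x u nn m] unfolding A_def B_def C_def d_def by blast
    qed
  qed
  have "measure P ?E \<le> measure P (((\<Union>t<n. A t) \<union> (\<Union>t<n. \<Union>s<t. B s t)) \<union> C)"
    using sub by (rule P.finite_measure_mono_AE) measurable
  also have "\<dots> \<le> measure P ((\<Union>t<n. A t) \<union> (\<Union>t<n. \<Union>s<t. B s t)) + measure P C"
    by (intro measure_Un_le) measurable
  also have "\<dots> \<le> measure P (\<Union>t<n. A t) + measure P (\<Union>t<n. \<Union>s<t. B s t) + measure P C"
    by (intro add_right_mono measure_Un_le) measurable
  also have "measure P (\<Union>t<n. A t) \<le> (\<Sum>t<n. measure P (A t))"
    by (rule P.finite_measure_subadditive_finite) auto
  also have "(\<Sum>t<n. measure P (A t)) = ?S"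
    unfolding A_def using \<theta> by (simp add: coordinate_tail)
  also have "measure P (\<Union>t<n. \<Union>s<t. B s t) \<le> (\<Sum>t<n. measure P (\<Union>s<t. B s t))"
    by (rule P.finite_measure_subadditive_finite) auto
  also have "\<dots> \<le> (\<Sum>t<n. \<Sum>s<t. measure P (B s t))"
    by (intro sum_mono P.finite_measure_subadditive_finite) auto
  also have "\<dots> \<le> (\<Sum>t<n. \<Sum>s<t. (d * x) powr (-(2 * \<alpha>)) * (\<theta> s powr \<alpha> * \<theta> t powr \<alpha>))"
    unfolding B_def using \<theta> d x by (intro sum_mono coordinate_pair_tail_le) auto
  also have "\<dots> = ?Q" by (simp add: sum_distrib_left)
  also have "measure P C \<le> ?R"
    unfolding C_def using u x by (intro weighted_series_tail_le \<theta> w V) auto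
  finally show ?thesis by simp
qed

text \<open>A single term larger than \<open>x\<close> already makes the series larger than \<open>x\<close>; the Bonferroni inequality
  bounds the probability of the union of these events from below.\<close>

lemma weighted_series_tail_lower:
  fixes n :: nat
  assumes \<theta>: "\<And>t. 0 < \<theta> t" and x: "0 < x"
  shows "(\<Sum>t<n. measure D {x / \<theta> t<..}) - x powr (-(2 * \<alpha>)) * (\<Sum>t<n. \<Sum>s<t. \<theta> s powr \<alpha> * \<theta> t powr \<alpha>)
    \<le> measure P {\<omega>. \<exists>m. x < (\<Sum>t<m. \<theta> t * \<omega> t)}"
proof -
  define A where "A t = {\<omega>. x < \<theta> t * \<omega> t}" for t
  have [measurable]: "A t \<in> sets P" for t unfolding A_def by measurable
  have "(\<Sum>t<n. measure D {x / \<theta> t<..}) = (\<Sum>t<n. measure P (A t))"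
    unfolding A_def using \<theta> by (simp add: coordinate_tail)
  also have "\<dots> \<le> measure P (\<Union>t<n. A t) + (\<Sum>t<n. \<Sum>s<t. measure P (A s \<inter> A t))"
    by (rule P.sum_measure_le_measure_UN_plus_pairs) simp
  also have "(\<Sum>t<n. \<Sum>s<t. measure P (A s \<inter> A t)) \<le>
      (\<Sum>t<n. \<Sum>s<t. x powr (-(2 * \<alpha>)) * (\<theta> s powr \<alpha> * \<theta> t powr \<alpha>))"
  proof (intro sum_mono)
    fix s t :: nat assume "s \<in> {..<t}"
    moreover have "A s \<inter> A t = {\<omega>. x < \<theta> s * \<omega> s \<and> x < \<theta> t * \<omega> t}" by (auto simp: A_def)
    ultimately show "measure P (A s \<inter> A t) \<le> x powr (-(2 * \<alpha>)) * (\<theta> s powr \<alpha> * \<theta> t powr \<alpha>)"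
      using \<theta> x by (simp only:) (rule coordinate_pair_tail_le, auto)
  qed
  also have "measure P (\<Union>t<n. A t) \<le> measure P {\<omega>. \<exists>m. x < (\<Sum>t<m. \<theta> t * \<omega> t)}"
  proof (rule P.finite_measure_mono_AE)
    show "AE \<omega> in P. \<omega> \<in> (\<Union>t<n. A t) \<longrightarrow> \<omega> \<in> {\<omega>. \<exists>m. x < (\<Sum>t<m. \<theta> t * \<omega> t)}"
      using AE_P_pos
    proof eventually_elim
      case (elim \<omega>)
      have "x < (\<Sum>t<Suc t. \<theta> t * \<omega> t)" if "x < \<theta> t * \<omega> t" for t
        using that sum_nonneg[of "{..<t}" "\<lambda>t. \<theta> t * \<omega> t"] elim \<theta> by (simp add: less_imp_le)
      thus ?case unfolding A_def by blast
    qed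
    show "{\<omega>. \<exists>m. x < (\<Sum>t<m. \<theta> t * \<omega> t)} \<in> sets P"
      using exceeds_event_measurable(1)[where x = x and n = 0 and \<theta> = \<theta>] by (simp add: atLeast0LessThan)
  qed
  finally show ?thesis by (simp add: sum_distrib_left)
qed

lemma powr_coordinate_tail_bounds:
  assumes "0 < \<theta>" "0 < x"
  shows "0 \<le> x powr \<alpha> * measure D {x / \<theta><..}" "x powr \<alpha> * measure D {x / \<theta><..} \<le> \<theta> powr \<alpha>"
proof -
  have "x powr \<alpha> * measure D {x / \<theta><..} \<le> x powr \<alpha> * (x / \<theta>) powr (-\<alpha>)"
    using assms by (intro mult_left_mono tail_le) auto
  also have "\<dots> = \<theta> powr \<alpha>"
    using assms by (simp add: powr_divide powr_minus field_simps)
  finally show "x powr \<alpha> * measure D {x / \<theta><..} \<le> \<theta> powr \<alpha>" .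
qed auto

text \<open>For fixed weights the tail of the series is asymptotically the sum of the tails of its terms. The
  statement is about a difference, scaled by \<open>x powr \<alpha>\<close>, because neither of the two quantities
  needs to converge.\<close>

lemma one_big_jump:
  assumes \<theta>: "\<And>t. 0 < \<theta> t" and w: "\<And>t. 0 < w t" "w sums 1"
    and V: "summable (\<lambda>t. w t powr (1 - q) * \<theta> t powr \<alpha>)"
  shows "((\<lambda>x. x powr \<alpha> * measure P {\<omega>. \<exists>m. x < (\<Sum>t<m. \<theta> t * \<omega> t)} -
    (\<Sum>t. x powr \<alpha> * measure D {x / \<theta> t<..})) \<longlongrightarrow> 0) at_top"
proof (rule tendstoI)
  fix e :: real assume e: "0 < e"
  define h where "h x t = x powr \<alpha> * measure D {x / \<theta> t<..}" for x t
  define z where "z t = \<theta> t powr \<alpha>" for t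
  define v where "v t = w t powr (1 - q)" for t
  have v: "1 \<le> v t" for t
    unfolding v_def using w q_ge_1 by (rule weight_powr_ge_1)
  have z: "0 \<le> z t" "z t \<le> v t * z t" for t
    using v[of t] mult_right_mono[of 1 "v t" "z t"] by (auto simp: z_def)
  have V': "summable (\<lambda>t. v t * z t)" using V by (simp add: v_def z_def)
  have Z: "summable z" by (rule summable_comparison_test'[OF V']) (use z in auto)
  have h: "0 \<le> h x t" "h x t \<le> z t" if "0 < x" for x t
    using powr_coordinate_tail_bounds[OF \<theta> that] by (auto simp: h_def z_def)
  have H: "summable (h x)" if "0 < x" for x
    by (rule summable_comparison_test'[OF Z]) (use h that in auto)

  \<comment> \<open>The contraction \<open>u\<close> is fixed first, then the number \<open>n\<close> of terms treated individually, whose choice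
    depends on \<open>u\<close> through \<open>c\<close>; the pairs vanish as \<open>x\<close> grows, for any fixed \<open>u\<close> and \<open>n\<close>.\<close>
  have "((\<lambda>u. \<bar>u powr (-\<kappa>) - 1\<bar> * suminf z) \<longlongrightarrow> \<bar>1 powr (-\<kappa>) - 1\<bar> * suminf z) (at_left (1::real))"
    by (intro tendsto_intros) auto
  hence "\<forall>\<^sub>F u in at_left (1::real). \<bar>u powr (-\<kappa>) - 1\<bar> * suminf z < e / 4"
    using e by (intro order_tendstoD(2)) auto
  moreover have "\<forall>\<^sub>F u in at_left (1::real). u \<in> {0<..<1}"
    by (rule eventually_at_left_real) simp
  ultimately have "\<forall>\<^sub>F u in at_left (1::real). 0 < u \<and> u < 1 \<and> \<bar>u powr (-\<kappa>) - 1\<bar> * suminf z < e / 4"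
    by eventually_elim auto
  then obtain u :: real where u: "0 < u" "u < 1" "\<bar>u powr (-\<kappa>) - 1\<bar> * suminf z < e / 4"
    using eventually_happens'[OF trivial_limit_at_left_real] by blast

  define c where "c = (1 + K) * ((1 - u) / 2) powr (-\<alpha>)"
  have c: "0 < c" using u K_nonneg by (simp add: c_def)
  obtain n1 where n1: "\<And>n. n1 \<le> n \<Longrightarrow> norm (\<Sum>t. v (t + n) * z (t + n)) < e / 4 / c"
    using suminf_exist_split[OF _ V', of "e / 4 / c"] e c by auto
  obtain n2 where n2: "\<And>n. n2 \<le> n \<Longrightarrow> norm (\<Sum>t. z (t + n)) < e / 4"
    using suminf_exist_split[OF _ Z, of "e / 4"] e by auto
  define n where "n = max n1 n2"
  have n_vz: "c * (\<Sum>t. v (t + n) * z (t + n)) < e / 4"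
  proof -
    have "(\<Sum>t. v (t + n) * z (t + n)) < e / 4 / c"
      using n1[of n] by (simp add: n_def abs_less_iff)
    thus ?thesis using c by (simp add: pos_less_divide_eq mult.commute)
  qed
  have n_z: "(\<Sum>t. z (t + n)) < e / 4"
    using n2[of n] by (simp add: n_def abs_less_iff)

  define Q where "Q = (\<Sum>t<n. \<Sum>s<t. \<theta> s powr \<alpha> * \<theta> t powr \<alpha>)"
  define d where "d = (1 - u) / (2 * (real n + 1))"
  have d: "0 < d" using u by (simp add: d_def)
  have neg: "((\<lambda>x. x powr (-\<alpha>)) \<longlongrightarrow> 0) at_top"
    using alpha_pos by (intro tendsto_neg_powr filterlim_ident) auto
  have "\<forall>\<^sub>F x in at_top. d powr (-(2 * \<alpha>)) * Q * x powr (-\<alpha>) < e / 4"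
    using tendsto_mult_right_zero[OF neg, of "d powr (-(2 * \<alpha>)) * Q"] e
    by (intro order_tendstoD(2)) auto
  moreover have "\<forall>\<^sub>F x in at_top. Q * x powr (-\<alpha>) < e / 4"
    using tendsto_mult_right_zero[OF neg, of Q] e by (intro order_tendstoD(2)) auto
  moreover have "\<forall>\<^sub>F x in at_top. (0::real) < x" by (rule eventually_gt_at_top)
  ultimately show "\<forall>\<^sub>F x in at_top. dist (x powr \<alpha> * measure P {\<omega>. \<exists>m. x < (\<Sum>t<m. \<theta> t * \<omega> t)} -
    (\<Sum>t. x powr \<alpha> * measure D {x / \<theta> t<..})) 0 < e"
  proof eventually_elim
    case (elim x)
    let ?p = "x powr \<alpha> * measure P {\<omega>. \<exists>m. x < (\<Sum>t<m. \<theta> t * \<omega> t)}"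
    have x: "0 < x" by fact
    have two: "x powr \<alpha> * x powr (-(2 * \<alpha>)) = x powr (-\<alpha>)" by (simp flip: powr_add)

    have "?p \<le> x powr \<alpha> * ((\<Sum>t<n. measure D {u * x / \<theta> t<..}) + (d * x) powr (-(2 * \<alpha>)) * Q +
        (1 + K) * ((1 - u) / 2 * x) powr (-\<alpha>) * (\<Sum>t. v (t + n) * z (t + n)))"
      unfolding Q_def d_def v_def z_def using u x
      by (intro mult_left_mono weighted_series_tail_upper \<theta> w V) auto
    also have "\<dots> = (\<Sum>t<n. x powr \<alpha> * measure D {u * x / \<theta> t<..}) +
        d powr (-(2 * \<alpha>)) * Q * (x powr \<alpha> * x powr (-(2 * \<alpha>))) +
        c * (\<Sum>t. v (t + n) * z (t + n)) * (x powr \<alpha> * x powr (-\<alpha>))"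
    proof -
      have "((1 - u) / 2 * x) powr (-\<alpha>) = ((1 - u) / 2) powr (-\<alpha>) * x powr (-\<alpha>)"
        "(d * x) powr (-(2 * \<alpha>)) = d powr (-(2 * \<alpha>)) * x powr (-(2 * \<alpha>))"
        using u d x by - (rule powr_mult; simp)+
      thus ?thesis by (simp only: c_def distrib_left sum_distrib_left mult_ac)
    qed
    also have "x powr \<alpha> * x powr (-\<alpha>) = 1" using x by (simp flip: powr_add)
    also have "(\<Sum>t<n. x powr \<alpha> * measure D {u * x / \<theta> t<..}) \<le> (\<Sum>t<n. u powr (-\<kappa>) * h x t)"
    proof (rule sum_mono)
      fix t
      have "measure D {u * (x / \<theta> t)<..} \<le> u powr (-\<kappa>) * measure D {x / \<theta> t<..}"
        using u x \<theta>[of t] by (intro tail_dilate) auto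
      thus "x powr \<alpha> * measure D {u * x / \<theta> t<..} \<le> u powr (-\<kappa>) * h x t"
        using mult_left_mono[of _ _ "x powr \<alpha>"] by (fastforce simp: h_def mult_ac)
    qed
    also have "\<dots> \<le> u powr (-\<kappa>) * suminf (h x)"
      using h[OF x] H[OF x] by (auto simp flip: sum_distrib_left intro!: mult_left_mono sum_le_suminf)
    also have "\<dots> = suminf (h x) + (u powr (-\<kappa>) - 1) * suminf (h x)" by (simp add: algebra_simps)
    also have "(u powr (-\<kappa>) - 1) * suminf (h x) \<le> \<bar>u powr (-\<kappa>) - 1\<bar> * suminf z"
      using h[OF x] H[OF x] Z by (intro mult_mono suminf_le suminf_nonneg) auto
    finally have upper: "?p - suminf (h x) < e"
      using u(3) n_vz elim two e by simp

    have "(\<Sum>t<n. h x t) - Q * x powr (-\<alpha>) =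
        x powr \<alpha> * ((\<Sum>t<n. measure D {x / \<theta> t<..}) - x powr (-(2 * \<alpha>)) * Q)"
      unfolding two[symmetric] h_def by (simp add: right_diff_distrib sum_distrib_left mult_ac)
    also have "\<dots> \<le> ?p"
      unfolding Q_def using x by (intro mult_left_mono weighted_series_tail_lower \<theta>) auto
    finally have "(\<Sum>t<n. h x t) - Q * x powr (-\<alpha>) \<le> ?p" .
    moreover have "suminf (h x) = (\<Sum>t. h x (t + n)) + (\<Sum>t<n. h x t)"
      by (rule suminf_split_initial_segment[OF H[OF x]])
    moreover have "(\<Sum>t. h x (t + n)) \<le> (\<Sum>t. z (t + n))"
      using h[OF x] H[OF x] Z by (intro suminf_le) (auto simp: summable_iff_shift)
    ultimately have lower: "-e < ?p - suminf (h x)"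
      using n_z elim e by linarith
    show ?case using upper lower by (simp add: dist_real_def h_def[abs_def] abs_less_iff)
  qed
qed

end

section \<open>Sums with random weights\<close>

text \<open>By monotone convergence the pointwise sum has a finite integral.\<close>

lemma AE_summable_of_summable_integral:
  fixes f :: "nat \<Rightarrow> 'a \<Rightarrow> real"
  assumes int: "\<And>t. integrable M (f t)" and nonneg: "\<And>t \<omega>. 0 \<le> f t \<omega>"
    and summable: "summable (\<lambda>t. \<integral>\<omega>. f t \<omega> \<partial>M)"
  shows "AE \<omega> in M. summable (\<lambda>t. f t \<omega>)"
proof -
  have [measurable]: "f t \<in> borel_measurable M" for t using int by auto
  have "(\<integral>\<^sup>+\<omega>. (\<Sum>t. ennreal (f t \<omega>)) \<partial>M) = (\<Sum>t. \<integral>\<^sup>+\<omega>. ennreal (f t \<omega>) \<partial>M)"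
    by (intro nn_integral_suminf) auto
  also have "\<dots> = (\<Sum>t. ennreal (\<integral>\<omega>. f t \<omega> \<partial>M))"
    using int nonneg by (intro suminf_cong nn_integral_eq_integral) auto
  also have "\<dots> \<noteq> \<infinity>"
    using summable nonneg by (simp add: ennreal_suminf_neq_top)
  finally have "AE \<omega> in M. (\<Sum>t. ennreal (f t \<omega>)) \<noteq> \<infinity>"
    by (intro nn_integral_PInf_AE) auto
  thus ?thesis
    by eventually_elim (use nonneg in \<open>auto intro!: summable_suminf_not_top\<close>)
qed

context dominated_tail_law
begin

context
  fixes M :: "'a measure" and \<Theta> :: "nat \<Rightarrow> 'a \<Rightarrow> real" and w :: "nat \<Rightarrow> real"
  assumes M: "prob_space M"
    and \<Theta>: "\<And>t. positive_rv M (\<Theta> t)"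
    and int: "\<And>t. integrable M (\<lambda>\<theta>. \<Theta> t \<theta> powr \<alpha>)"
    and w: "\<And>t. 0 < w t" "w sums 1"
    and summable_moments: "summable (\<lambda>t. w t powr (1 - q) * (\<integral>\<theta>. \<Theta> t \<theta> powr \<alpha> \<partial>M))"
begin

interpretation M: prob_space M by (rule M)
interpretation MP: pair_prob_space M P ..

lemma measurable_weights [measurable]: "\<Theta> t \<in> borel_measurable M"
  using \<Theta> by (simp add: positive_rv_def)

lemma weighted_powers_integrals:
  "integrable M (\<lambda>\<theta>. w t powr (1 - q) * \<Theta> t \<theta> powr \<alpha>)"
  "summable (\<lambda>t. \<integral>\<theta>. w t powr (1 - q) * \<Theta> t \<theta> powr \<alpha> \<partial>M)"
  using int summable_moments by auto

text \<open>Almost every realization of the weights satisfies the hypotheses of \<open>one_big_jump\<close>.\<close>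

lemma AE_weighted_powers_summable:
  "AE \<theta> in M. (\<forall>t. 0 < \<Theta> t \<theta>) \<and> summable (\<lambda>t. w t powr (1 - q) * \<Theta> t \<theta> powr \<alpha>)"
proof -
  have "AE \<theta> in M. summable (\<lambda>t. w t powr (1 - q) * \<Theta> t \<theta> powr \<alpha>)"
    using weighted_powers_integrals by (intro AE_summable_of_summable_integral) auto
  moreover have "AE \<theta> in M. \<forall>t. 0 < \<Theta> t \<theta>"
    unfolding AE_all_countable using \<Theta> by (auto simp: positive_rv_def)
  ultimately show ?thesis by eventually_elim auto
qed

lemma AE_weighted_sum_summable:
  "AE z in M \<Otimes>\<^sub>M P. (\<forall>t. 0 < \<Theta> t (fst z) * snd z t) \<and> summable (\<lambda>t. \<Theta> t (fst z) * snd z t)"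
proof (rule MP.AE_pair_measure)
  have "{z \<in> space (M \<Otimes>\<^sub>M P). \<forall>t. 0 < \<Theta> t (fst z) * snd z t} \<in> sets (M \<Otimes>\<^sub>M P)"
    by measurable
  moreover have "{z \<in> space (M \<Otimes>\<^sub>M P). Cauchy (\<lambda>m. \<Sum>t<m. \<Theta> t (fst z) * snd z t)} \<in> sets (M \<Otimes>\<^sub>M P)"
    by (rule sets_Collect_Cauchy) measurable
  ultimately have "{z \<in> space (M \<Otimes>\<^sub>M P). (\<forall>t. 0 < \<Theta> t (fst z) * snd z t) \<and>
      Cauchy (\<lambda>m. \<Sum>t<m. \<Theta> t (fst z) * snd z t)} \<in> sets (M \<Otimes>\<^sub>M P)"
    by (rule sets.sets_Collect_conj[rotated])
  thus "{z \<in> space (M \<Otimes>\<^sub>M P). (\<forall>t. 0 < \<Theta> t (fst z) * snd z t) \<and>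
      summable (\<lambda>t. \<Theta> t (fst z) * snd z t)} \<in> sets (M \<Otimes>\<^sub>M P)"
    by (simp add: summable_iff_convergent Cauchy_convergent_iff)
  show "AE \<theta> in M. AE \<omega> in P. (\<forall>t. 0 < \<Theta> t (fst (\<theta>, \<omega>)) * snd (\<theta>, \<omega>) t) \<and>
      summable (\<lambda>t. \<Theta> t (fst (\<theta>, \<omega>)) * snd (\<theta>, \<omega>) t)"
    using AE_weighted_powers_summable
  proof eventually_elim
    case (elim \<theta>)
    have "AE \<omega> in P. summable (\<lambda>t. \<Theta> t \<theta> * \<omega> t)"
      using elim w by (intro AE_weighted_series_summable[where w = w]) auto
    with AE_P_pos show ?case by eventually_elim (use elim in auto)
  qed
qed

text \<open>A version of the conditional probability, given the weights, that the series exceeds \<open>x\<close>. It is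
  expressed by partial sums, so that it has the intended value even before the series is known to
  converge.\<close>

definition conditional_tail :: "real \<Rightarrow> 'a \<Rightarrow> real" where
  "conditional_tail x \<theta> = measure P {\<omega>. \<exists>m. x < (\<Sum>t<m. \<Theta> t \<theta> * \<omega> t)}"

lemma measurable_conditional_tail [measurable]: "conditional_tail x \<in> borel_measurable M"
  and weighted_sum_tail_eq: "measure (M \<Otimes>\<^sub>M P) {z \<in> space (M \<Otimes>\<^sub>M P). x < (\<Sum>t. \<Theta> t (fst z) * snd z t)} =
    (\<integral>\<theta>. conditional_tail x \<theta> \<partial>M)"
proof -
  define E where "E = {z \<in> space (M \<Otimes>\<^sub>M P). \<exists>m. x < (\<Sum>t<m. \<Theta> t (fst z) * snd z t)}"
  have E: "E \<in> sets (M \<Otimes>\<^sub>M P)" unfolding E_def by measurable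
  have slice: "Pair \<theta> -` E = {\<omega>. \<exists>m. x < (\<Sum>t<m. \<Theta> t \<theta> * \<omega> t)}" if "\<theta> \<in> space M" for \<theta>
    using that by (auto simp: E_def space_pair_measure)
  have "(\<lambda>\<theta>. enn2real (emeasure P (Pair \<theta> -` E))) \<in> borel_measurable M"
    using P.measurable_emeasure_Pair[OF E] by measurable
  thus meas: "conditional_tail x \<in> borel_measurable M"
    by (rule measurable_cong[THEN iffD1, rotated]) (simp add: slice conditional_tail_def measure_def)
  have "measure (M \<Otimes>\<^sub>M P) {z \<in> space (M \<Otimes>\<^sub>M P). x < (\<Sum>t. \<Theta> t (fst z) * snd z t)} = measure (M \<Otimes>\<^sub>M P) E"
  proof (rule measure_eq_AE)
    show "AE z in M \<Otimes>\<^sub>M P. z \<in> {z \<in> space (M \<Otimes>\<^sub>M P). x < (\<Sum>t. \<Theta> t (fst z) * snd z t)} \<longleftrightarrow> z \<in> E"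
      using AE_weighted_sum_summable
    proof eventually_elim
      case (elim z)
      let ?f = "\<lambda>t. \<Theta> t (fst z) * snd z t"
      have "x < suminf ?f \<longleftrightarrow> (\<exists>m. x < (\<Sum>t<m. ?f t))"
      proof
        assume "x < suminf ?f"
        hence "\<forall>\<^sub>F m in sequentially. x < (\<Sum>t<m. ?f t)"
          using elim by (intro order_tendstoD(1)[OF summable_LIMSEQ]) auto
        thus "\<exists>m. x < (\<Sum>t<m. ?f t)"
          using eventually_happens'[OF sequentially_bot] by blast
      next
        assume "\<exists>m. x < (\<Sum>t<m. ?f t)"
        then obtain m where "x < (\<Sum>t<m. ?f t)" by blast
        also have "\<dots> \<le> suminf ?f" using elim by (intro sum_le_suminf) (auto simp: less_imp_le)
        finally show "x < suminf ?f" .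
      qed
      thus ?case by (auto simp: E_def)
    qed
  qed (use E in measurable)
  also have "\<dots> = enn2real (\<integral>\<^sup>+\<theta>. emeasure P (Pair \<theta> -` E) \<partial>M)"
    using P.emeasure_pair_measure_alt[OF E] by (simp add: measure_def)
  also have "(\<integral>\<^sup>+\<theta>. emeasure P (Pair \<theta> -` E) \<partial>M) = (\<integral>\<^sup>+\<theta>. ennreal (conditional_tail x \<theta>) \<partial>M)"
    by (intro nn_integral_cong) (simp add: slice conditional_tail_def P.emeasure_eq_measure)
  also have "enn2real \<dots> = (\<integral>\<theta>. conditional_tail x \<theta> \<partial>M)"
    using meas by (intro integral_eq_nn_integral[symmetric]) (auto simp: conditional_tail_def)
  finally show "measure (M \<Otimes>\<^sub>M P) {z \<in> space (M \<Otimes>\<^sub>M P). x < (\<Sum>t. \<Theta> t (fst z) * snd z t)} =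
    (\<integral>\<theta>. conditional_tail x \<theta> \<partial>M)" .
qed

text \<open>Integration of \<open>one_big_jump\<close> over the weights. For a fixed realization of the weights, the scaled sum
  of the tails is eventually a sum of values of \<open>g\<close>, but from a level on that depends on the realization.
  The replacement is therefore made before the integration; the purpose is to choose \<open>g\<close> such that its
  expectations can be summed in closed form.\<close>

lemma weighted_sum_tail_asymptotics:
  fixes g :: "real \<Rightarrow> real \<Rightarrow> real"
  assumes g: "\<And>x \<theta>. 0 \<le> g x \<theta>" "\<And>x \<theta>. g x \<theta> \<le> \<theta> powr \<alpha>" "\<And>x. g x \<in> borel_measurable borel"
    and approx: "\<And>\<theta>. (\<And>t. 0 < \<theta> t) \<Longrightarrow> summable (\<lambda>t. \<theta> t powr \<alpha>) \<Longrightarrow>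
      \<forall>\<^sub>F x in at_top. (\<Sum>t. x powr \<alpha> * measure D {x / \<theta> t<..}) = (\<Sum>t. g x (\<theta> t))"
  shows "((\<lambda>x. x powr \<alpha> * measure (M \<Otimes>\<^sub>M P) {z \<in> space (M \<Otimes>\<^sub>M P). x < (\<Sum>t. \<Theta> t (fst z) * snd z t)} -
    (\<Sum>t. \<integral>\<theta>. g x (\<Theta> t \<theta>) \<partial>M)) \<longlongrightarrow> 0) at_top"
proof -
  note [measurable] = g(3)
  define V where "V \<theta> = (\<Sum>t. w t powr (1 - q) * \<Theta> t \<theta> powr \<alpha>)" for \<theta>
  define G where "G x \<theta> = (\<Sum>t. g x (\<Theta> t \<theta>))" for x \<theta>
  have term_le: "g x (\<Theta> t \<theta>) \<le> w t powr (1 - q) * \<Theta> t \<theta> powr \<alpha>" "\<Theta> t \<theta> powr \<alpha> \<le> w t powr (1 - q) * \<Theta> t \<theta> powr \<alpha>" for x t \<theta>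
    using g(2)[of x "\<Theta> t \<theta>"] mult_right_mono[OF weight_powr_ge_1[OF w q_ge_1, of t], of "\<Theta> t \<theta> powr \<alpha>"] by auto
  have int_V: "integrable M V"
    unfolding V_def
  proof (rule integrable_suminf)
    show "AE \<theta> in M. summable (\<lambda>t. norm (w t powr (1 - q) * \<Theta> t \<theta> powr \<alpha>))"
      using AE_weighted_powers_summable by eventually_elim auto
  qed (use weighted_powers_integrals in auto)
  have g_integrable: "integrable M (\<lambda>\<theta>. g x (\<Theta> t \<theta>))" for x t
    by (rule Bochner_Integration.integrable_bound[OF int[of t]]) (use g in auto)
  have g_summable: "AE \<theta> in M. summable (\<lambda>t. norm (g x (\<Theta> t \<theta>)))" for x
    using AE_weighted_powers_summable
  proof eventually_elim
    case (elim \<theta>)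
    show ?case
      by (rule summable_comparison_test'[OF conjunct2[OF elim]]) (use g(1) term_le in auto)
  qed
  have g_integrals_summable: "summable (\<lambda>t. \<integral>\<theta>. norm (g x (\<Theta> t \<theta>)) \<partial>M)" for x
  proof (rule summable_comparison_test'[OF weighted_powers_integrals(2)])
    fix t
    have "(\<integral>\<theta>. norm (g x (\<Theta> t \<theta>)) \<partial>M) \<le> (\<integral>\<theta>. w t powr (1 - q) * \<Theta> t \<theta> powr \<alpha> \<partial>M)"
      using g_integrable weighted_powers_integrals(1) g(1) term_le(1)
      by (intro integral_mono) (auto simp: abs_of_nonneg)
    moreover have "0 \<le> (\<integral>\<theta>. norm (g x (\<Theta> t \<theta>)) \<partial>M)"
      by (rule Bochner_Integration.integral_nonneg) simp
    ultimately show "norm (\<integral>\<theta>. norm (g x (\<Theta> t \<theta>)) \<partial>M) \<le> (\<integral>\<theta>. w t powr (1 - q) * \<Theta> t \<theta> powr \<alpha> \<partial>M)"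
      by simp
  qed
  have int_G: "integrable M (G x)" and integral_G: "(\<integral>\<theta>. G x \<theta> \<partial>M) = (\<Sum>t. \<integral>\<theta>. g x (\<Theta> t \<theta>) \<partial>M)" for x
    unfolding G_def using g_integrable g_summable g_integrals_summable
    by (auto intro: integrable_suminf integral_suminf)
  have int_tail: "integrable M (conditional_tail x)" for x
    by (rule M.integrable_const_bound[where B = 1]) (auto simp: conditional_tail_def)

  \<comment> \<open>The tail bound dominates the first term by \<open>(1 + K) * V \<theta>\<close>, and \<open>G x \<theta>\<close> lies between 0 and \<open>V \<theta>\<close>.\<close>
  have "((\<lambda>x. \<integral>\<theta>. x powr \<alpha> * conditional_tail x \<theta> - G x \<theta> \<partial>M) \<longlongrightarrow> (\<integral>\<theta>. 0 \<partial>M)) at_top"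
  proof (rule integral_dominated_convergence_at_top)
    show "integrable M (\<lambda>\<theta>. (1 + K) * V \<theta> + V \<theta>)" using int_V by simp
    show "AE \<theta> in M. ((\<lambda>x. x powr \<alpha> * conditional_tail x \<theta> - G x \<theta>) \<longlongrightarrow> 0) at_top"
      using AE_weighted_powers_summable
    proof eventually_elim
      case (elim \<theta>)
      have "summable (\<lambda>t. \<Theta> t \<theta> powr \<alpha>)"
        by (rule summable_comparison_test'[OF conjunct2[OF elim]]) (use term_le in auto)
      hence "\<forall>\<^sub>F x in at_top. (\<Sum>t. x powr \<alpha> * measure D {x / \<Theta> t \<theta><..}) = G x \<theta>"
        unfolding G_def using elim by (intro approx) auto
      hence "\<forall>\<^sub>F x in at_top. x powr \<alpha> * conditional_tail x \<theta> - (\<Sum>t. x powr \<alpha> * measure D {x / \<Theta> t \<theta><..}) =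
          x powr \<alpha> * conditional_tail x \<theta> - G x \<theta>"
        by eventually_elim simp
      moreover have "((\<lambda>x. x powr \<alpha> * conditional_tail x \<theta> -
          (\<Sum>t. x powr \<alpha> * measure D {x / \<Theta> t \<theta><..})) \<longlongrightarrow> 0) at_top"
        unfolding conditional_tail_def using elim w by (intro one_big_jump[where w = w]) auto
      ultimately show ?case by (rule Lim_transform_eventually[rotated])
    qed
    show "\<forall>\<^sub>F x in at_top. AE \<theta> in M. norm (x powr \<alpha> * conditional_tail x \<theta> - G x \<theta>) \<le> (1 + K) * V \<theta> + V \<theta>"
      using eventually_gt_at_top[of 0]
    proof eventually_elim
      case x: (elim x)
      show ?case using AE_weighted_powers_summable g_summable[of x]
      proof eventually_elim
        case (elim \<theta>)
        have "conditional_tail x \<theta> \<le> (1 + K) * x powr (-\<alpha>) * V \<theta>"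
          using weighted_series_tail_le[of "\<lambda>t. \<Theta> t \<theta>" w x 0] elim w x
          by (simp add: conditional_tail_def V_def atLeast0LessThan)
        hence "x powr \<alpha> * conditional_tail x \<theta> \<le> x powr \<alpha> * ((1 + K) * x powr (-\<alpha>) * V \<theta>)"
          by (intro mult_left_mono) auto
        also have "\<dots> = (1 + K) * V \<theta> * (x powr \<alpha> * x powr (-\<alpha>))" by (simp only: mult_ac)
        also have "x powr \<alpha> * x powr (-\<alpha>) = 1" using x by (simp flip: powr_add)
        finally have 1: "x powr \<alpha> * conditional_tail x \<theta> \<le> (1 + K) * V \<theta>" by simp
        have 2: "0 \<le> x powr \<alpha> * conditional_tail x \<theta>" by (simp add: conditional_tail_def)
        have "summable (\<lambda>t. g x (\<Theta> t \<theta>))" using elim(2) g(1) by (simp add: abs_of_nonneg)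
        hence "0 \<le> G x \<theta>" "G x \<theta> \<le> V \<theta>"
          unfolding G_def V_def using g(1) term_le(1) elim by (auto intro!: suminf_nonneg suminf_le)
        with 1 2 show ?case unfolding real_norm_def abs_le_iff by linarith
      qed
    qed
  qed (use int_G in \<open>auto intro!: borel_measurable_diff borel_measurable_integrable\<close>)
  moreover have "(\<integral>\<theta>. x powr \<alpha> * conditional_tail x \<theta> - G x \<theta> \<partial>M) =
      x powr \<alpha> * (\<integral>\<theta>. conditional_tail x \<theta> \<partial>M) - (\<Sum>t. \<integral>\<theta>. g x (\<Theta> t \<theta>) \<partial>M)" for x
    using int_tail[of x] int_G[of x] by (simp add: integral_G)
  ultimately show ?thesis by (simp add: weighted_sum_tail_eq)
qed

end
end

lemma product_space_sequences:
  fixes M :: "'a measure" and D :: "real measure" and \<Theta> :: "nat \<Rightarrow> 'a \<Rightarrow> real"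
  assumes M: "prob_space M" and D: "prob_space D" and [measurable_cong]: "sets D = sets borel"
    and [measurable]: "\<And>t. \<Theta> t \<in> borel_measurable M"
  defines "N \<equiv> M \<Otimes>\<^sub>M (\<Pi>\<^sub>M t\<in>(UNIV :: nat set). D)"
  shows "enlarged_prob_space N fst M" "iid N (\<lambda>t z. snd z t)" "distr N borel (\<lambda>z. snd z t) = D"
    "indep_sequences N (\<lambda>t z. snd z t) (\<lambda>t z. \<Theta> t (fst z))"
proof -
  let ?P = "\<Pi>\<^sub>M t\<in>(UNIV :: nat set). D"
  interpret M: prob_space M by fact
  interpret P: product_prob_space "\<lambda>_::nat. D" UNIV
    using D by (intro product_prob_spaceI)
  interpret MP: pair_prob_space M ?P ..
  have [measurable_cong]: "sets ?P = sets (\<Pi>\<^sub>M t\<in>UNIV. borel)"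
    using assms(3) by (intro sets_PiM_cong) auto
  have fst_N: "distr N M fst = M"
    unfolding N_def by (rule P.distr_pair_fst)
  have snd_N: "distr N ?P snd = ?P"
  proof -
    have "distr N ?P snd = distr (distr (?P \<Otimes>\<^sub>M M) N (\<lambda>(x, y). (y, x))) ?P snd"
      unfolding N_def by (subst MP.distr_pair_swap) simp
    also have "\<dots> = distr (?P \<Otimes>\<^sub>M M) ?P fst"
      unfolding N_def by (subst distr_distr) (auto simp: comp_def case_prod_beta)
    also have "\<dots> = ?P" by (rule M.distr_pair_fst)
    finally show ?thesis .
  qed
  have N: "prob_space N" unfolding N_def by unfold_locales
  interpret N: prob_space N by fact
  have [measurable]: "fst \<in> measurable N M" "snd \<in> measurable N ?P" by (auto simp: N_def)
  have [measurable]: "(\<lambda>z. snd z t) \<in> borel_measurable N" for t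
    by (rule measurable_compose[OF \<open>snd \<in> measurable N ?P\<close>]) measurable
  show "enlarged_prob_space N fst M"
    using N fst_N by (simp add: enlarged_prob_space_def)
  have coord: "distr N borel (\<lambda>z. snd z t) = D" for t
  proof -
    have "distr N borel (\<lambda>z. snd z t) = distr (distr N ?P snd) D (\<lambda>\<omega>. \<omega> t)"
      by (subst distr_distr) (auto simp: comp_def assms(3) intro!: distr_cong)
    thus ?thesis unfolding snd_N by (simp add: P.PiM_component)
  qed
  thus "distr N borel (\<lambda>z. snd z t) = D" .
  have "N.indep_vars (\<lambda>_. borel) (\<lambda>t z. snd z t) UNIV"
  proof (subst N.indep_vars_iff_distr_eq_PiM)
    have "distr N (\<Pi>\<^sub>M t\<in>UNIV. borel) (\<lambda>z. \<lambda>t\<in>UNIV. snd z t) = distr N ?P snd"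
      by (intro distr_cong) (auto intro!: sets_PiM_cong simp: assms(3))
    thus "distr N (\<Pi>\<^sub>M t\<in>UNIV. borel) (\<lambda>z. \<lambda>t\<in>UNIV. snd z t) = (\<Pi>\<^sub>M t\<in>UNIV. distr N borel (\<lambda>z. snd z t))"
      by (simp add: snd_N coord)
  qed auto
  thus "iid N (\<lambda>t z. snd z t)" by (simp add: iid_def coord)
  show "indep_sequences N (\<lambda>t z. snd z t) (\<lambda>t z. \<Theta> t (fst z))"
    unfolding indep_sequences_def N.indep_var_distribution_eq
  proof (intro conjI)
    let ?S = "\<Pi>\<^sub>M t\<in>(UNIV :: nat set). (borel :: real measure)"
    let ?T = "\<lambda>\<theta> t. \<Theta> t \<theta>"
    have [measurable]: "?T \<in> measurable M ?S" by (intro measurable_PiM_single') auto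
    have [measurable]: "(\<lambda>\<omega>. \<omega>) \<in> measurable ?P ?S" by measurable
    interpret T: prob_space "distr M ?S ?T" by (rule M.prob_space_distr) measurable
    show "(\<lambda>z t. snd z t) \<in> measurable N ?S" "(\<lambda>z t. \<Theta> t (fst z)) \<in> measurable N ?S"
      by measurable
    have "distr N ?S (\<lambda>z t. snd z t) = distr (distr N ?P snd) ?S (\<lambda>\<omega>. \<omega>)"
      by (subst distr_distr) (auto simp: comp_def)
    moreover have "distr N ?S (\<lambda>z t. \<Theta> t (fst z)) = distr (distr N M fst) ?S ?T"
      by (subst distr_distr) (auto simp: comp_def)
    ultimately have "distr N ?S (\<lambda>z t. snd z t) \<Otimes>\<^sub>M distr N ?S (\<lambda>z t. \<Theta> t (fst z)) =
        distr ?P ?S (\<lambda>\<omega>. \<omega>) \<Otimes>\<^sub>M distr M ?S ?T"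
      by (simp only: fst_N snd_N)
    also have "\<dots> = distr (?P \<Otimes>\<^sub>M M) (?S \<Otimes>\<^sub>M ?S) (\<lambda>(x, y). (x, ?T y))"
      by (intro pair_measure_distr) (auto intro: T.sigma_finite_measure_axioms)
    also have "\<dots> = distr (distr (?P \<Otimes>\<^sub>M M) N (\<lambda>(x, y). (y, x))) (?S \<Otimes>\<^sub>M ?S) (\<lambda>z. ((\<lambda>t. snd z t), (\<lambda>t. \<Theta> t (fst z))))"
      by (subst distr_distr) (auto simp: comp_def case_prod_beta' N_def)
    also have "distr (?P \<Otimes>\<^sub>M M) N (\<lambda>(x, y). (y, x)) = N"
      unfolding N_def by (rule MP.distr_pair_swap[symmetric])
    finally show "distr N ?S (\<lambda>z t. snd z t) \<Otimes>\<^sub>M distr N ?S (\<lambda>z t. \<Theta> t (fst z)) =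
      distr N (?S \<Otimes>\<^sub>M ?S) (\<lambda>z. ((\<lambda>t. snd z t), (\<lambda>t. \<Theta> t (fst z))))" .
  qed
qed

section \<open>Moments of the weights\<close>

text \<open>The polar form of the integrand, whose phase is \<open>\<beta>\<close> times the logarithm of \<open>T\<close>.\<close>

lemma complex_moment_eq:
  fixes T :: "'a \<Rightarrow> real"
  assumes [measurable]: "T \<in> borel_measurable M" and pos: "AE \<omega> in M. 0 < T \<omega>"
  shows "(\<integral>\<omega>. complex_of_real (T \<omega>) powr Complex \<alpha> \<beta> \<partial>M) =
    (\<integral>\<omega>. complex_of_real (T \<omega> powr \<alpha>) * cis (\<beta> * ln (T \<omega>)) \<partial>M)"
proof (rule Bochner_Integration.integral_cong_AE)
  show "AE \<omega> in M. complex_of_real (T \<omega>) powr Complex \<alpha> \<beta> =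
      complex_of_real (T \<omega> powr \<alpha>) * cis (\<beta> * ln (T \<omega>))"
    using pos
  proof eventually_elim
    case (elim \<omega>)
    have "Complex \<alpha> \<beta> * Ln (complex_of_real (T \<omega>)) = Complex (\<alpha> * ln (T \<omega>)) (\<beta> * ln (T \<omega>))"
      using elim by (simp add: Ln_of_real complex_eq_iff)
    thus ?case using elim
      by (simp add: powr_def exp_eq_polar scaleR_conv_of_real[symmetric] exp_of_real)
  qed
  have "complex_of_real y powr Complex \<alpha> \<beta> = (if y = 0 then 0 else
      exp (Complex \<alpha> \<beta> * (complex_of_real (ln \<bar>y\<bar>) + complex_of_real (if y < 0 then pi else 0) * \<i>)))" for y
    by (simp add: powr_def Ln_of_real')
  thus "(\<lambda>\<omega>. complex_of_real (T \<omega>) powr Complex \<alpha> \<beta>) \<in> borel_measurable M" by simp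
  show "(\<lambda>\<omega>. complex_of_real (T \<omega> powr \<alpha>) * cis (\<beta> * ln (T \<omega>))) \<in> borel_measurable M"
    unfolding cis.ctr Complex_eq by measurable
qed

lemma (in prob_space) expectation_powr_pos:
  fixes T :: "'a \<Rightarrow> real"
  assumes "AE \<omega> in M. 0 < T \<omega>" "integrable M (\<lambda>\<omega>. T \<omega> powr \<alpha>)"
  shows "0 < expectation (\<lambda>\<omega>. T \<omega> powr \<alpha>)"
proof (rule ccontr)
  assume "\<not> ?thesis"
  moreover have "0 \<le> expectation (\<lambda>\<omega>. T \<omega> powr \<alpha>)"
    by (rule Bochner_Integration.integral_nonneg) simp
  ultimately have "expectation (\<lambda>\<omega>. T \<omega> powr \<alpha>) = 0" by simp
  hence "AE \<omega> in M. T \<omega> powr \<alpha> = 0"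
    using assms(2) by (subst (asm) integral_nonneg_eq_0_iff_AE) auto
  with assms(1) have "AE \<omega> in M. False" by eventually_elim auto
  thus False by (simp add: AE_False)
qed

text \<open>Both moment conditions take the same form with \<open>q = 1\<close> in the first case and \<open>q = \<alpha> + \<epsilon>\<close> in the
  second, since \<open>\<theta> powr \<alpha>\<close> is at most \<open>\<theta> powr (\<alpha> + \<epsilon>) + \<theta> powr (\<alpha> - \<epsilon>)\<close>.\<close>

lemma (in prob_space) moment_exponent_exists:
  assumes \<Theta>: "\<And>t. positive_rv M (\<Theta> t)" and "0 < \<alpha>"
    and "\<alpha> < 1 \<Longrightarrow> RW1 M \<alpha> \<Theta>" "1 \<le> \<alpha> \<Longrightarrow> RW2 M \<alpha> \<Theta>"
  obtains q where "1 \<le> q" "\<alpha> < q" "\<And>t. integrable M (\<lambda>\<omega>. \<Theta> t \<omega> powr \<alpha>)"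
    "summable (\<lambda>t. expectation (\<lambda>\<omega>. \<Theta> t \<omega> powr \<alpha>) powr (1 / q))"
proof -
  have [measurable]: "\<Theta> t \<in> borel_measurable M" for t using \<Theta> by (auto simp: positive_rv_def)
  have pos: "AE \<omega> in M. 0 < \<Theta> t \<omega>" for t using \<Theta> by (auto simp: positive_rv_def)
  let ?m = "\<lambda>\<epsilon> t. \<integral>\<omega>. (\<Theta> t \<omega> powr (\<alpha> + \<epsilon>) + \<Theta> t \<omega> powr (\<alpha> - \<epsilon>)) \<partial>M"
  have le: "\<theta> powr \<alpha> \<le> \<theta> powr (\<alpha> + \<epsilon>) + \<theta> powr (\<alpha> - \<epsilon>)" if "0 < \<theta>" "0 < \<epsilon>" for \<theta> \<epsilon> :: real
  proof (cases "1 \<le> \<theta>")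
    case True
    hence "\<theta> powr \<alpha> \<le> \<theta> powr (\<alpha> + \<epsilon>)" using that by (intro powr_mono) auto
    thus ?thesis by (simp add: add_increasing2)
  next
    case False
    hence "\<theta> powr \<alpha> \<le> \<theta> powr (\<alpha> - \<epsilon>)" using that by (intro powr_mono') auto
    thus ?thesis by (simp add: add_increasing)
  qed
  have moments: "integrable M (\<lambda>\<omega>. \<Theta> t \<omega> powr \<alpha>)" "expectation (\<lambda>\<omega>. \<Theta> t \<omega> powr \<alpha>) \<le> ?m \<epsilon> t"
    if "0 < \<epsilon>" and int: "integrable M (\<lambda>\<omega>. \<Theta> t \<omega> powr (\<alpha> + \<epsilon>) + \<Theta> t \<omega> powr (\<alpha> - \<epsilon>))" for \<epsilon> t
  proof -
    have AE: "AE \<omega> in M. \<Theta> t \<omega> powr \<alpha> \<le> \<Theta> t \<omega> powr (\<alpha> + \<epsilon>) + \<Theta> t \<omega> powr (\<alpha> - \<epsilon>)"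
      using pos[of t] by eventually_elim (rule le, use that in auto)
    show int': "integrable M (\<lambda>\<omega>. \<Theta> t \<omega> powr \<alpha>)"
      by (rule Bochner_Integration.integrable_bound[OF int]) (use AE in auto)
    show "expectation (\<lambda>\<omega>. \<Theta> t \<omega> powr \<alpha>) \<le> ?m \<epsilon> t"
      using int' int AE by (rule integral_mono_AE)
  qed
  show ?thesis
  proof (cases "\<alpha> < 1")
    case True
    then obtain \<epsilon> where \<epsilon>: "0 < \<epsilon>"
      "\<And>t. integrable M (\<lambda>\<omega>. \<Theta> t \<omega> powr (\<alpha> + \<epsilon>) + \<Theta> t \<omega> powr (\<alpha> - \<epsilon>))" "summable (?m \<epsilon>)"
      using assms(3) unfolding RW1_def by blast
    have "summable (\<lambda>t. expectation (\<lambda>\<omega>. \<Theta> t \<omega> powr \<alpha>))"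
      by (rule summable_comparison_test'[OF \<epsilon>(3)])
        (use moments[OF \<epsilon>(1,2)] in \<open>auto intro!: abs_leI order_trans[OF _ integral_nonneg_AE]\<close>)
    thus ?thesis using moments(1)[OF \<epsilon>(1,2)] True by (intro that[of 1]) auto
  next
    case False
    then obtain \<epsilon> where \<epsilon>: "0 < \<epsilon>"
      "\<And>t. integrable M (\<lambda>\<omega>. \<Theta> t \<omega> powr (\<alpha> + \<epsilon>) + \<Theta> t \<omega> powr (\<alpha> - \<epsilon>))"
      "summable (\<lambda>t. ?m \<epsilon> t powr (1 / (\<alpha> + \<epsilon>)))"
      using assms(4) unfolding RW2_def not_less by blast
    have "summable (\<lambda>t. expectation (\<lambda>\<omega>. \<Theta> t \<omega> powr \<alpha>) powr (1 / (\<alpha> + \<epsilon>)))"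
      by (rule summable_comparison_test'[OF \<epsilon>(3)])
        (use moments[OF \<epsilon>(1,2)] \<epsilon>(1) \<open>0 < \<alpha>\<close> in \<open>auto intro!: powr_mono2 integral_nonneg_AE\<close>)
    thus ?thesis using moments(1)[OF \<epsilon>(1,2)] False \<epsilon>(1) by (intro that[of "\<alpha> + \<epsilon>"]) auto
  qed
qed

text \<open>The weights are proportional to \<open>e t powr (1 / q)\<close>. Then \<open>w t powr (1 - q) * e t\<close> is itself
  proportional to \<open>e t powr (1 / q)\<close>, hence summable.\<close>

lemma weights_exist:
  fixes e :: "nat \<Rightarrow> real"
  assumes e: "\<And>t. 0 < e t" and q: "1 \<le> q" and summable: "summable (\<lambda>t. e t powr (1 / q))"
  shows "\<exists>w. (\<forall>t. 0 < w t) \<and> w sums 1 \<and>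
    summable (\<lambda>t. w t powr (1 - q) * e t)"
proof -
  define c where "c t = e t powr (1 / q)" for t
  define C where "C = suminf c"
  have c: "0 < c t" for t using e[of t] by (simp add: c_def)
  have sc: "summable c" using summable by (simp add: c_def[abs_def])
  have C: "0 < C" unfolding C_def using sc c by (rule suminf_pos)
  show ?thesis
  proof (intro exI[of _ "\<lambda>t. c t / C"] conjI allI)
    show "0 < c t / C" for t using c C by simp
    show "(\<lambda>t. c t / C) sums 1"
      using sums_divide[OF summable_sums[OF sc], of C] C by (simp add: C_def)
    have "(c t / C) powr (1 - q) * e t = C powr (q - 1) * c t" for t
    proof -
      have "e t = c t powr q" using e[of t] q by (simp add: c_def powr_powr)
      thus ?thesis using c[of t] C by (simp add: powr_divide powr_diff field_simps)
    qed
    thus "summable (\<lambda>t. (c t / C) powr (1 - q) * e t)" using sc by (simp add: summable_mult)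
  qed
qed

section \<open>The log-periodic Pareto law\<close>

text \<open>The amplitude is so small that, with \<open>a = lp_amplitude \<alpha> b\<close>, both \<open>\<alpha> * (1 + a * cos t) + a * b * sin t\<close>
  and \<open>\<alpha> * (1 + a * cos t) - a * b * sin t\<close> are nonnegative. The former makes the tail decreasing, and
  the latter makes the tail times \<open>x powr (2 * \<alpha>)\<close> increasing.\<close>

definition lp_amplitude :: "real \<Rightarrow> real \<Rightarrow> real" where
  "lp_amplitude \<alpha> b = \<alpha> / (2 * (\<alpha> + b))"

text \<open>This is the tail of the log-periodic Pareto law on \<open>[1, \<infinity>)\<close> only; below 1 the tail of the law is 1.\<close>

definition lp_tail :: "real \<Rightarrow> real \<Rightarrow> real \<Rightarrow> real" where
  "lp_tail \<alpha> b x = x powr (-\<alpha>) * (1 + lp_amplitude \<alpha> b * cos (b * ln x)) / (1 + lp_amplitude \<alpha> b)"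

definition lp_density :: "real \<Rightarrow> real \<Rightarrow> real \<Rightarrow> real" where
  "lp_density \<alpha> b x = x powr (-\<alpha> - 1) *
     (\<alpha> * (1 + lp_amplitude \<alpha> b * cos (b * ln x)) + lp_amplitude \<alpha> b * b * sin (b * ln x)) / (1 + lp_amplitude \<alpha> b)"

definition lp_law :: "real \<Rightarrow> real \<Rightarrow> real measure" where
  "lp_law \<alpha> b = density lborel (\<lambda>x. ennreal (lp_density \<alpha> b x * indicator {1..} x))"

locale lp_parameters =
  fixes \<alpha> b :: real
  assumes alpha_pos: "0 < \<alpha>" and b_pos: "0 < b"
begin

abbreviation "a \<equiv> lp_amplitude \<alpha> b"

lemma amplitude_bounds: "0 < a" "a \<le> 1/2" "a * b \<le> \<alpha> / 2"
  using alpha_pos b_pos by (auto simp: lp_amplitude_def field_simps)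

lemma abs_amplitude_cos: "\<bar>a * cos t\<bar> \<le> a"
proof -
  have "a * \<bar>cos t\<bar> \<le> a * 1"
    using amplitude_bounds(1) by (intro mult_left_mono) auto
  thus ?thesis using amplitude_bounds(1) by (simp add: abs_mult)
qed

lemma abs_amplitude_sin: "\<bar>a * b * sin t\<bar> \<le> \<alpha> / 2"
proof -
  have "a * b * \<bar>sin t\<bar> \<le> a * b * 1"
    using amplitude_bounds(1) b_pos by (intro mult_left_mono) auto
  moreover have "\<bar>a * b * sin t\<bar> = a * b * \<bar>sin t\<bar>"
    using amplitude_bounds(1) b_pos by (simp add: abs_mult)
  ultimately show ?thesis using amplitude_bounds(3) by linarith
qed

text \<open>These combinations are, up to positive factors, the density and the derivative of
  \<open>x powr (2 * \<alpha>) * lp_tail \<alpha> b x\<close>.\<close>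

lemma hazard_combination_bounds:
  "0 \<le> \<alpha> * (1 + a * cos t) + a * b * sin t" "\<alpha> * (1 + a * cos t) + a * b * sin t \<le> 2 * \<alpha>"
  "0 \<le> \<alpha> * (1 + a * cos t) - a * b * sin t"
proof -
  have "\<bar>a * cos t\<bar> \<le> 1/2" using abs_amplitude_cos[of t] amplitude_bounds by linarith
  hence "\<alpha> * \<bar>a * cos t\<bar> \<le> \<alpha> * (1/2)"
    using alpha_pos by (intro mult_left_mono) auto
  hence *: "\<bar>\<alpha> * (a * cos t)\<bar> \<le> \<alpha> / 2"
    using alpha_pos by (simp add: abs_mult)
  show "0 \<le> \<alpha> * (1 + a * cos t) + a * b * sin t" "\<alpha> * (1 + a * cos t) + a * b * sin t \<le> 2 * \<alpha>"
    "0 \<le> \<alpha> * (1 + a * cos t) - a * b * sin t"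
    using * abs_amplitude_sin[of t] alpha_pos by (auto simp: distrib_left abs_le_iff)
qed

lemma lp_density_nonneg: "0 \<le> lp_density \<alpha> b x"
  unfolding lp_density_def using hazard_combination_bounds(1)[of "b * ln x"] amplitude_bounds
  by (intro divide_nonneg_nonneg mult_nonneg_nonneg) auto

lemma lp_density_le: "lp_density \<alpha> b x \<le> 2 * \<alpha> * x powr (-\<alpha> - 1)"
proof -
  have "lp_density \<alpha> b x \<le> x powr (-\<alpha> - 1) * (2 * \<alpha>) / (1 + a)"
    unfolding lp_density_def using hazard_combination_bounds(2)[of "b * ln x"] amplitude_bounds
    by (intro divide_right_mono mult_left_mono) auto
  also have "\<dots> \<le> x powr (-\<alpha> - 1) * (2 * \<alpha>) / 1"
    using amplitude_bounds alpha_pos by (intro divide_left_mono) auto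
  finally show ?thesis by (simp add: mult_ac)
qed

lemma lp_tail_has_derivative:
  assumes "0 < x"
  shows "(lp_tail \<alpha> b has_real_derivative - lp_density \<alpha> b x) (at x)"
proof -
  have "((\<lambda>x. x powr (-\<alpha>) * (1 + a * cos (b * ln x)) / (1 + a)) has_real_derivative
      (x powr (-\<alpha>) * (a * (- sin (b * ln x) * (b * (1 / x)))) +
        (-\<alpha> * x powr (-\<alpha> - 1)) * (1 + a * cos (b * ln x))) / (1 + a)) (at x)"
    using assms amplitude_bounds(1) by (auto intro!: derivative_eq_intros)
  moreover have "(x powr (-\<alpha>) * (a * (- sin (b * ln x) * (b * (1 / x)))) +
      (-\<alpha> * x powr (-\<alpha> - 1)) * (1 + a * cos (b * ln x))) = - (x powr (-\<alpha> - 1) *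
        (\<alpha> * (1 + a * cos (b * ln x)) + a * b * sin (b * ln x)))"
    using assms by (simp add: powr_diff field_simps)
  ultimately show ?thesis
    unfolding lp_tail_def[abs_def] lp_density_def by simp
qed

lemma lp_tail_bounds: "0 < x \<Longrightarrow> 0 < lp_tail \<alpha> b x" "lp_tail \<alpha> b x \<le> x powr (-\<alpha>)"
proof -
  have p: "0 < 1 + a * cos (b * ln x)" "1 + a * cos (b * ln x) \<le> 1 + a"
    using abs_amplitude_cos[of "b * ln x"] amplitude_bounds by auto
  show "0 < lp_tail \<alpha> b x" if "0 < x"
    unfolding lp_tail_def using p amplitude_bounds that by (intro divide_pos_pos mult_pos_pos) auto
  have "lp_tail \<alpha> b x \<le> x powr (-\<alpha>) * (1 + a) / (1 + a)"
    unfolding lp_tail_def using p amplitude_bounds by (intro divide_right_mono mult_left_mono) auto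
  thus "lp_tail \<alpha> b x \<le> x powr (-\<alpha>)" using amplitude_bounds by simp
qed

lemma lp_tail_1 [simp]: "lp_tail \<alpha> b 1 = 1"
  using amplitude_bounds by (simp add: lp_tail_def)

lemma lp_tail_tendsto_0: "(lp_tail \<alpha> b \<longlongrightarrow> 0) at_top"
proof (rule tendsto_sandwich[of "\<lambda>_. 0" _ _ "\<lambda>x. x powr (-\<alpha>)"])
  show "((\<lambda>x::real. x powr (-\<alpha>)) \<longlongrightarrow> 0) at_top"
    using alpha_pos by (intro tendsto_neg_powr filterlim_ident) auto
  show "\<forall>\<^sub>F x in at_top. 0 \<le> lp_tail \<alpha> b x"
    using eventually_gt_at_top[of 0] by eventually_elim (rule less_imp_le[OF lp_tail_bounds(1)])
qed (use lp_tail_bounds(2) in auto)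

lemma borel_measurable_lp_density [measurable]: "lp_density \<alpha> b \<in> borel_measurable borel"
  unfolding lp_density_def[abs_def] by measurable

lemma emeasure_lp_law_atLeast:
  assumes "1 \<le> x"
  shows "emeasure (lp_law \<alpha> b) {x..} = ennreal (lp_tail \<alpha> b x)"
proof -
  have "emeasure (lp_law \<alpha> b) {x..} =
      (\<integral>\<^sup>+ y. ennreal (lp_density \<alpha> b y * indicator {1..} y) * indicator {x..} y \<partial>lborel)"
    unfolding lp_law_def by (subst emeasure_density) auto
  also have "\<dots> = (\<integral>\<^sup>+ y. ennreal (lp_density \<alpha> b y) * indicator {x..} y \<partial>lborel)"
    using assms by (intro nn_integral_cong) (auto simp: indicator_def)
  also have "\<dots> = ennreal (0 - (- lp_tail \<alpha> b x))"
  proof (rule nn_integral_FTC_atLeast)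
    show "((\<lambda>y. - lp_tail \<alpha> b y) \<longlongrightarrow> 0) at_top"
      using tendsto_minus[OF lp_tail_tendsto_0] by simp
    show "((\<lambda>y. - lp_tail \<alpha> b y) has_real_derivative lp_density \<alpha> b y) (at y)" if "x \<le> y" for y
      using DERIV_minus[OF lp_tail_has_derivative[of y]] that assms by auto
  qed (auto simp: lp_density_nonneg)
  finally show ?thesis by simp
qed

lemma sets_lp_law [simp, measurable_cong]: "sets (lp_law \<alpha> b) = sets borel"
  and space_lp_law [simp]: "space (lp_law \<alpha> b) = UNIV"
  by (auto simp: lp_law_def)

lemma AE_lp_law_ge_1: "AE x in lp_law \<alpha> b. 1 \<le> x"
  unfolding lp_law_def by (subst AE_density) (auto simp: indicator_def)

lemma prob_space_lp_law: "prob_space (lp_law \<alpha> b)"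
proof (rule prob_spaceI)
  have "emeasure (lp_law \<alpha> b) (space (lp_law \<alpha> b)) = emeasure (lp_law \<alpha> b) {1..}"
    using AE_lp_law_ge_1 by (intro emeasure_eq_AE) auto
  thus "emeasure (lp_law \<alpha> b) (space (lp_law \<alpha> b)) = 1"
    by (simp add: emeasure_lp_law_atLeast)
qed

lemma lp_law_tail:
  assumes "1 \<le> x"
  shows "measure (lp_law \<alpha> b) {x<..} = lp_tail \<alpha> b x"
proof -
  have "AE y in lborel. y \<noteq> x" by (rule AE_lborel_singleton)
  hence "AE y in lp_law \<alpha> b. y \<noteq> x"
    unfolding lp_law_def by (subst AE_density) auto
  hence "emeasure (lp_law \<alpha> b) {x<..} = emeasure (lp_law \<alpha> b) {x..}"
    by (intro emeasure_eq_AE) auto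
  thus ?thesis
    using emeasure_lp_law_atLeast[OF assms] lp_tail_bounds(1)[of x] assms by (simp add: measure_def)
qed

lemma lp_law_tail_le:
  assumes "0 < x"
  shows "measure (lp_law \<alpha> b) {x<..} \<le> x powr (-\<alpha>)"
proof (cases "1 \<le> x")
  case True
  thus ?thesis by (simp add: lp_law_tail lp_tail_bounds)
next
  case False
  interpret prob_space "lp_law \<alpha> b" by (rule prob_space_lp_law)
  have "x powr 0 \<le> x powr (-\<alpha>)"
    using False assms alpha_pos by (intro powr_mono') auto
  thus ?thesis using assms prob_le_1[of "{x<..}"] order_trans[OF prob_le_1[of "{x<..}"]] by simp
qed

text \<open>The reason why the tail grows at most polynomially, with exponent \<open>2 * \<alpha>\<close>, under contraction.\<close>

lemma powr_lp_tail_mono: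
  assumes "0 < x" "x \<le> y"
  shows "x powr (2 * \<alpha>) * lp_tail \<alpha> b x \<le> y powr (2 * \<alpha>) * lp_tail \<alpha> b y"
proof (rule DERIV_nonneg_imp_nondecreasing[OF assms(2)])
  fix z assume z: "x \<le> z" "z \<le> y"
  have "1 + a \<noteq> 0" using amplitude_bounds by linarith
  have "((\<lambda>x. x powr (2 * \<alpha>) * lp_tail \<alpha> b x) has_real_derivative
      z powr (\<alpha> - 1) * (\<alpha> * (1 + a * cos (b * ln z)) - a * b * sin (b * ln z)) / (1 + a)) (at z)"
  proof (rule DERIV_cong)
    have "((\<lambda>x. x powr (2 * \<alpha>)) has_real_derivative 2 * \<alpha> * z powr (2 * \<alpha> - 1)) (at z)"
      using z assms by (auto intro!: derivative_eq_intros)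
    thus "((\<lambda>x. x powr (2 * \<alpha>) * lp_tail \<alpha> b x) has_real_derivative
       z powr (2 * \<alpha>) * (- lp_density \<alpha> b z) + (2 * \<alpha> * z powr (2 * \<alpha> - 1)) * lp_tail \<alpha> b z) (at z)"
      using z assms by (intro DERIV_mult' lp_tail_has_derivative) auto
    have alg: "p * p * - (1 / p / z * C / d) + 2 * \<alpha> * (p * p / z) * (1 / p * B / d) =
        p / z * (2 * \<alpha> * B - C) / d" if "p \<noteq> 0" "z \<noteq> 0" "d \<noteq> 0" for p z d C B :: real
      using that by (simp add: field_simps)
    have powrs: "z powr (2 * \<alpha>) = z powr \<alpha> * z powr \<alpha>"
      "z powr (2 * \<alpha> - 1) = z powr \<alpha> * z powr \<alpha> / z" "z powr (\<alpha> - 1) = z powr \<alpha> / z"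
      "z powr (-\<alpha> - 1) = 1 / z powr \<alpha> / z" "z powr (-\<alpha>) = 1 / z powr \<alpha>"
      using z assms by (simp_all add: powr_diff powr_minus_divide flip: powr_add)
    show "z powr (2 * \<alpha>) * (- lp_density \<alpha> b z) + (2 * \<alpha> * z powr (2 * \<alpha> - 1)) * lp_tail \<alpha> b z =
      z powr (\<alpha> - 1) * (\<alpha> * (1 + a * cos (b * ln z)) - a * b * sin (b * ln z)) / (1 + a)"
      unfolding lp_density_def lp_tail_def powrs
      using z assms \<open>1 + a \<noteq> 0\<close> by (subst alg) (auto simp: algebra_simps)
  qed
  moreover have "0 \<le> z powr (\<alpha> - 1) * (\<alpha> * (1 + a * cos (b * ln z)) - a * b * sin (b * ln z)) / (1 + a)"
    using hazard_combination_bounds(3)[of "b * ln z"] amplitude_bounds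
    by (intro divide_nonneg_nonneg mult_nonneg_nonneg) auto
  ultimately show "\<exists>d. ((\<lambda>x. x powr (2 * \<alpha>) * lp_tail \<alpha> b x) has_real_derivative d) (at z) \<and> 0 \<le> d"
    by blast
qed

lemma lp_law_tail_dilate:
  assumes u: "0 < u" "u \<le> 1" and z: "0 < z"
  shows "measure (lp_law \<alpha> b) {u * z<..} \<le> u powr (-(2 * \<alpha>)) * measure (lp_law \<alpha> b) {z<..}"
proof -
  interpret prob_space "lp_law \<alpha> b" by (rule prob_space_lp_law)
  have u1: "1 \<le> u powr (-(2 * \<alpha>))"
    using powr_mono'[of "-(2*\<alpha>)" 0 u] u alpha_pos by simp
  consider "z < 1" | "1 \<le> z" "u * z < 1" | "1 \<le> u * z" "1 \<le> z"
    using u z mult_left_le_one_le[of z u] by linarith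
  thus ?thesis
  proof cases
    case 1
    have "measure (lp_law \<alpha> b) {z<..} = 1"
      using AE_lp_law_ge_1 1 by (subst prob_eq_1) (auto elim!: eventually_mono)
    thus ?thesis using order_trans[OF prob_le_1[of "{u*z<..}"] u1] by simp
  next
    case 2
    have "1 \<le> z powr (2 * \<alpha>) * lp_tail \<alpha> b z"
      using powr_lp_tail_mono[of 1 z] 2 by simp
    also have "\<dots> \<le> u powr (-(2 * \<alpha>)) * lp_tail \<alpha> b z"
    proof (rule mult_right_mono)
      have "z powr (2 * \<alpha>) \<le> (1 / u) powr (2 * \<alpha>)"
        using 2 u alpha_pos z by (intro powr_mono2) (auto simp: field_simps)
      also have "\<dots> = u powr (-(2 * \<alpha>))"
        using u by (simp add: powr_divide powr_minus_divide)
      finally show "z powr (2 * \<alpha>) \<le> u powr (-(2 * \<alpha>))" .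
    qed (use lp_tail_bounds(1)[OF z] in auto)
    finally show ?thesis using 2 order_trans[OF prob_le_1[of "{u*z<..}"]] by (simp add: lp_law_tail)
  next
    case 3
    have "(u * z) powr (2 * \<alpha>) * lp_tail \<alpha> b (u * z) \<le> z powr (2 * \<alpha>) * lp_tail \<alpha> b z"
      using u z mult_left_le_one_le[of z u] by (intro powr_lp_tail_mono) auto
    hence "z powr (2 * \<alpha>) * (u powr (2 * \<alpha>) * lp_tail \<alpha> b (u * z)) \<le> z powr (2 * \<alpha>) * lp_tail \<alpha> b z"
      using u z by (simp add: powr_mult mult_ac)
    hence "u powr (2 * \<alpha>) * lp_tail \<alpha> b (u * z) \<le> lp_tail \<alpha> b z"
      using z by (subst (asm) mult_le_cancel_left_pos) auto
    thus ?thesis using 3 u by (simp add: lp_law_tail powr_minus field_simps)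
  qed
qed

text \<open>The density is at most \<open>2 * \<alpha> * x powr (-\<alpha> - 1)\<close>, for which the truncated moment has an elementary
  antiderivative.\<close>

lemma lp_law_truncated_moment:
  assumes q: "\<alpha> < q" and z: "0 < z"
  shows "(\<integral>\<^sup>+ x. ennreal (x powr q * indicator {..z} x) \<partial>lp_law \<alpha> b) \<le>
    ennreal (2 * \<alpha> / (q - \<alpha>) * z powr (q - \<alpha>))"
proof (cases "1 \<le> z")
  case False
  have "(\<integral>\<^sup>+ x. ennreal (x powr q * indicator {..z} x) \<partial>lp_law \<alpha> b) = (\<integral>\<^sup>+ x. 0 \<partial>lp_law \<alpha> b)"
    using AE_lp_law_ge_1 False by (intro nn_integral_cong_AE) (auto elim!: eventually_mono simp: indicator_def)
  thus ?thesis by simp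
next
  case True
  let ?F = "\<lambda>x. 2 * \<alpha> / (q - \<alpha>) * x powr (q - \<alpha>)"
  have "(\<integral>\<^sup>+ x. ennreal (x powr q * indicator {..z} x) \<partial>lp_law \<alpha> b) =
     (\<integral>\<^sup>+ x. ennreal (lp_density \<alpha> b x * indicator {1..} x) * ennreal (x powr q * indicator {..z} x) \<partial>lborel)"
    unfolding lp_law_def by (subst nn_integral_density) auto
  also have "\<dots> \<le> (\<integral>\<^sup>+ x. ennreal (2 * \<alpha> * x powr (q - \<alpha> - 1)) * indicator {1..z} x \<partial>lborel)"
  proof (rule nn_integral_mono)
    fix x :: real
    have "lp_density \<alpha> b x * x powr q \<le> 2 * \<alpha> * x powr (q - \<alpha> - 1)"
    proof -
      have "lp_density \<alpha> b x * x powr q \<le> 2 * \<alpha> * x powr (-\<alpha> - 1) * x powr q"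
        by (intro mult_right_mono lp_density_le) auto
      also have "\<dots> = 2 * \<alpha> * x powr (q - \<alpha> - 1)"
        by (simp add: mult.assoc flip: powr_add) (simp add: algebra_simps)
      finally show ?thesis .
    qed
    thus "ennreal (lp_density \<alpha> b x * indicator {1..} x) * ennreal (x powr q * indicator {..z} x) \<le>
        ennreal (2 * \<alpha> * x powr (q - \<alpha> - 1)) * indicator {1..z} x"
      using lp_density_nonneg[of x]
      by (auto simp: indicator_def ennreal_mult[symmetric] intro!: ennreal_leI)
  qed
  also have "\<dots> = ennreal (?F z - ?F 1)"
    using True q alpha_pos by (intro nn_integral_FTC_Icc) (auto intro!: derivative_eq_intros)
  also have "\<dots> \<le> ennreal (?F z)"
    using q alpha_pos by (intro ennreal_leI) auto
  finally show ?thesis .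
qed

text \<open>Dilation by \<open>exp (pi / b)\<close> shifts the phase of the oscillation by half a period. Along the sequences
  \<open>exp ((2 * pi * k + c) / b)\<close> the ratio of the tails is therefore constant, but its value differs for
  \<open>c = 0\<close>, where a maximum of the oscillation is compared with a minimum, and \<open>c = pi\<close>, where it is the
  other way round.\<close>

lemma lp_law_tail_not_regularly_varying:
  "\<not> (\<forall>u>0. ((\<lambda>x. measure (lp_law \<alpha> b) {u * x<..} / measure (lp_law \<alpha> b) {x<..}) \<longlongrightarrow> u powr \<rho>) at_top)"
proof
  assume *: "\<forall>u>0. ((\<lambda>x. measure (lp_law \<alpha> b) {u * x<..} / measure (lp_law \<alpha> b) {x<..}) \<longlongrightarrow> u powr \<rho>) at_top"
  define u where "u = exp (pi / b)"
  have u: "1 \<le> u" using b_pos by (simp add: u_def)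
  have ratio: "u powr \<rho> = u powr (-\<alpha>) * ((1 + a * cos (c + pi)) / (1 + a * cos c))" for c
  proof -
    define x where "x k = exp ((2 * pi * real k + c) / b)" for k
    have "filterlim x at_top sequentially"
      unfolding x_def using b_pos by real_asymp
    moreover have "((\<lambda>x. measure (lp_law \<alpha> b) {u * x<..} / measure (lp_law \<alpha> b) {x<..}) \<longlongrightarrow> u powr \<rho>) at_top"
      using * u by auto
    ultimately have lim: "((\<lambda>k. measure (lp_law \<alpha> b) {u * x k<..} / measure (lp_law \<alpha> b) {x k<..}) \<longlonglongrightarrow> u powr \<rho>)"
      by (rule filterlim_compose[rotated])
    have "\<forall>\<^sub>F k in sequentially. 1 \<le> x k"
      using \<open>filterlim x at_top sequentially\<close> by (auto simp: filterlim_at_top)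
    hence "\<forall>\<^sub>F k in sequentially. measure (lp_law \<alpha> b) {u * x k<..} / measure (lp_law \<alpha> b) {x k<..} =
       u powr (-\<alpha>) * ((1 + a * cos (c + pi)) / (1 + a * cos c))"
    proof eventually_elim
      case (elim k)
      have "1 \<le> u * x k" using u elim mult_mono[of 1 u 1 "x k"] by simp
      have per: "cos (2 * pi * real k) = 1" "sin (2 * pi * real k) = 0"
        using cos_2npi[of k] sin_2npi[of k] by (simp_all add: mult_ac)
      have "b * ln (x k) = c + 2 * pi * real k"
        using b_pos by (simp add: x_def)
      hence c1: "cos (b * ln (x k)) = cos c"
        using per by (simp add: cos_add)
      have "b * ln (u * x k) = (c + pi) + 2 * pi * real k"
        using b_pos by (simp add: x_def u_def ln_mult field_simps)
      hence c2: "cos (b * ln (u * x k)) = cos (c + pi)"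
        using per by (simp only: cos_add[of "c + pi"])
      show ?case
        using elim \<open>1 \<le> u * x k\<close> c1 c2 u amplitude_bounds
        by (simp add: lp_law_tail lp_tail_def powr_mult)
    qed
    hence "((\<lambda>k. measure (lp_law \<alpha> b) {u * x k<..} / measure (lp_law \<alpha> b) {x k<..}) \<longlonglongrightarrow>
       u powr (-\<alpha>) * ((1 + a * cos (c + pi)) / (1 + a * cos c)))"
      by (rule tendsto_eventually)
    with lim show ?thesis using LIMSEQ_unique by blast
  qed
  have "u powr (-\<alpha>) * ((1 - a) / (1 + a)) = u powr (-\<alpha>) * ((1 + a) / (1 - a))"
    using ratio[of 0] ratio[of pi] by simp
  hence "(1 - a) / (1 + a) = (1 + a) / (1 - a)"
    using u by (subst (asm) mult_left_cancel) auto
  thus False using amplitude_bounds by (simp add: field_simps)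
qed

end

lemma (in lp_parameters) dominated_tail_law_lp_law:
  assumes "1 \<le> q" "\<alpha> < q"
  shows "dominated_tail_law (lp_law \<alpha> b) \<alpha> (2 * \<alpha>) q (2 * \<alpha> / (q - \<alpha>))"
proof -
  interpret prob_space "lp_law \<alpha> b" by (rule prob_space_lp_law)
  show ?thesis
  proof
    show "AE x in lp_law \<alpha> b. 0 < x"
      using AE_lp_law_ge_1 by eventually_elim simp
  qed (use assms alpha_pos lp_law_tail_le lp_law_tail_dilate lp_law_truncated_moment in auto)
qed

context lp_parameters
begin

text \<open>The tail at \<open>x / \<theta>\<close> scaled by \<open>x powr \<alpha>\<close>, according to the formula that is valid for \<open>x \<ge> \<theta>\<close>, but used
  for all \<open>x\<close>. The scale \<open>x\<close> enters through its phase only.\<close>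

definition lp_profile :: "real \<Rightarrow> real \<Rightarrow> real" where
  "lp_profile x \<theta> = \<theta> powr \<alpha> * (1 + a * cos (b * (ln x - ln \<theta>))) / (1 + a)"

lemma lp_profile_eq:
  assumes "0 < \<theta>" "0 < x"
  shows "lp_profile x \<theta> = x powr \<alpha> * lp_tail \<alpha> b (x / \<theta>)"
proof -
  have "x powr \<alpha> * (x / \<theta>) powr (-\<alpha>) = \<theta> powr \<alpha>"
    using assms by (simp add: powr_divide powr_minus field_simps)
  thus ?thesis
    using assms unfolding lp_profile_def lp_tail_def
    by (simp add: ln_div flip: mult.assoc)
qed

lemma lp_profile_bounds: "0 \<le> lp_profile x \<theta>" "lp_profile x \<theta> \<le> \<theta> powr \<alpha>"
proof -
  have p: "0 \<le> 1 + a * cos (b * (ln x - ln \<theta>))" "1 + a * cos (b * (ln x - ln \<theta>)) \<le> 1 + a"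
    using abs_amplitude_cos[of "b * (ln x - ln \<theta>)"] amplitude_bounds by auto
  show "0 \<le> lp_profile x \<theta>"
    unfolding lp_profile_def using p amplitude_bounds by (intro divide_nonneg_nonneg mult_nonneg_nonneg) auto
  have "lp_profile x \<theta> \<le> \<theta> powr \<alpha> * (1 + a) / (1 + a)"
    unfolding lp_profile_def using p amplitude_bounds by (intro divide_right_mono mult_left_mono) auto
  thus "lp_profile x \<theta> \<le> \<theta> powr \<alpha>" using amplitude_bounds by simp
qed

lemma borel_measurable_lp_profile [measurable]: "lp_profile x \<in> borel_measurable borel"
  unfolding lp_profile_def[abs_def] by measurable

text \<open>Weights with summable powers are bounded, and beyond their bound all terms are in the range in which
  the formula for the tail is exact.\<close>

lemma eventually_sum_tails_eq_sum_profiles: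
  assumes \<theta>: "\<And>t. 0 < \<theta> t" and summable: "summable (\<lambda>t. \<theta> t powr \<alpha>)"
  shows "\<forall>\<^sub>F x in at_top. (\<Sum>t. x powr \<alpha> * measure (lp_law \<alpha> b) {x / \<theta> t<..}) = (\<Sum>t. lp_profile x (\<theta> t))"
proof -
  have "Bseq (\<lambda>t. \<theta> t powr \<alpha>)"
    using summable_LIMSEQ_zero[OF summable] by (intro convergent_imp_Bseq) (auto simp: convergent_def)
  then obtain B where B: "0 < B" "\<And>t. \<theta> t powr \<alpha> \<le> B"
    by (auto simp: Bseq_def)
  have \<theta>_le: "\<theta> t \<le> B powr (1 / \<alpha>)" for t
  proof -
    have "(\<theta> t powr \<alpha>) powr (1 / \<alpha>) \<le> B powr (1 / \<alpha>)"
      using B alpha_pos by (intro powr_mono2) auto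
    thus ?thesis using \<theta>[of t] alpha_pos by (simp add: powr_powr)
  qed
  show ?thesis
    using eventually_ge_at_top[of "B powr (1 / \<alpha>)"] eventually_gt_at_top[of 0]
  proof eventually_elim
    case (elim x)
    have "1 \<le> x / \<theta> t" for t using \<theta>_le[of t] \<theta>[of t] elim by (simp add: field_simps)
    thus ?case using \<theta> elim by (simp add: lp_law_tail lp_profile_eq)
  qed
qed

text \<open>The addition theorem turns the oscillating part into the real part of the complex moment of order
  \<open>\<alpha> + i \<beta>\<close>, rotated by a phase that depends on \<open>x\<close> only. Summation over the weights therefore reduces to
  the series of complex moments, whatever \<open>x\<close> is.\<close>

lemma integral_lp_profile:
  assumes [measurable]: "T \<in> borel_measurable M" and pos: "AE \<omega> in M. 0 < T \<omega>"
    and int: "integrable M (\<lambda>\<omega>. T \<omega> powr \<alpha>)" and \<beta>: "\<bar>\<beta>\<bar> = b"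
  shows "(\<integral>\<omega>. lp_profile x (T \<omega>) \<partial>M) = ((\<integral>\<omega>. T \<omega> powr \<alpha> \<partial>M) +
    a * Re (cis (- (\<beta> * ln x)) * (\<integral>\<omega>. complex_of_real (T \<omega>) powr Complex \<alpha> \<beta> \<partial>M))) / (1 + a)"
proof -
  define g where "g \<omega> = complex_of_real (T \<omega> powr \<alpha>) * cis (\<beta> * ln (T \<omega>))" for \<omega>
  have [measurable]: "g \<in> borel_measurable M" unfolding g_def cis.ctr Complex_eq by measurable
  have "integrable M g"
    by (rule Bochner_Integration.integrable_bound[OF int]) (auto simp: g_def norm_mult)
  have g_eq: "(\<integral>\<omega>. complex_of_real (T \<omega>) powr Complex \<alpha> \<beta> \<partial>M) = (\<integral>\<omega>. g \<omega> \<partial>M)"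
    unfolding g_def using pos by (intro complex_moment_eq) auto
  have Re_eq: "Re (cis (- (\<beta> * ln x)) * g \<omega>) = T \<omega> powr \<alpha> * cos (b * (ln x - ln (T \<omega>)))" for \<omega>
  proof -
    have "\<beta> = b \<or> \<beta> = -b" using \<beta> by linarith
    hence "cos (b * (ln x - ln (T \<omega>))) = cos (- (\<beta> * (ln x - ln (T \<omega>))))"
      unfolding cos_minus by (elim disjE) (simp_all only: mult_minus_left cos_minus)
    also have "- (\<beta> * (ln x - ln (T \<omega>))) = - (\<beta> * ln x) + \<beta> * ln (T \<omega>)"
      by (simp add: algebra_simps)
    also have "cos \<dots> = Re (cis (- (\<beta> * ln x)) * cis (\<beta> * ln (T \<omega>)))"
      by (simp only: cis_mult cis.sel)
    finally show ?thesis by (simp add: g_def algebra_simps)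
  qed
  have int_cg: "integrable M (\<lambda>\<omega>. cis (- (\<beta> * ln x)) * g \<omega>)"
    using \<open>integrable M g\<close> by (intro integrable_mult_right) auto
  have "(\<integral>\<omega>. lp_profile x (T \<omega>) \<partial>M) =
      (\<integral>\<omega>. (T \<omega> powr \<alpha> + a * Re (cis (- (\<beta> * ln x)) * g \<omega>)) / (1 + a) \<partial>M)"
    unfolding Re_eq lp_profile_def by (intro Bochner_Integration.integral_cong) (auto simp: algebra_simps)
  also have "\<dots> = ((\<integral>\<omega>. T \<omega> powr \<alpha> \<partial>M) + a * (\<integral>\<omega>. Re (cis (- (\<beta> * ln x)) * g \<omega>) \<partial>M)) / (1 + a)"
    using int integrable_Re[OF int_cg] by simp
  also have "(\<integral>\<omega>. Re (cis (- (\<beta> * ln x)) * g \<omega>) \<partial>M) = Re (cis (- (\<beta> * ln x)) * (\<integral>\<omega>. g \<omega> \<partial>M))"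
    using integral_Re[OF int_cg] \<open>integrable M g\<close> by simp
  finally show ?thesis by (simp only: g_eq)
qed

end

section \<open>Regular variation of the sum without regular variation of the summands\<close>

lemma regularly_varying_tail_of_power_limit:
  assumes X: "X \<in> borel_measurable N" and N: "prob_space N" and L: "0 < L"
    and lim: "((\<lambda>x. x powr \<alpha> * measure N {\<omega> \<in> space N. x < X \<omega>}) \<longlongrightarrow> L) at_top"
  shows "regularly_varying_tail N X (-\<alpha>)"
proof -
  interpret prob_space N by fact
  define F where "F x = measure N {\<omega> \<in> space N. x < X \<omega>}" for x
  have [measurable]: "X \<in> borel_measurable N" by fact
  have lim': "((\<lambda>x. x powr \<alpha> * F x) \<longlongrightarrow> L) at_top" using lim by (simp add: F_def)
  have anti: "F y \<le> F x" if "x \<le> y" for x y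
    unfolding F_def using that by (intro finite_measure_mono) auto
  have "\<forall>\<^sub>F x in at_top. 0 < x powr \<alpha> * F x"
    using lim' L by (rule order_tendstoD(1))
  hence F_pos: "0 < F x" for x
  proof -
    assume "\<forall>\<^sub>F x in at_top. 0 < x powr \<alpha> * F x"
    then obtain y where "x \<le> y" "0 < y powr \<alpha> * F y"
      unfolding eventually_at_top_linorder by (metis linear)
    hence "0 < F y" by (simp add: zero_less_mult_iff)
    thus "0 < F x" using anti[OF \<open>x \<le> y\<close>] by linarith
  qed
  have "((\<lambda>x. F (u * x) / F x) \<longlongrightarrow> u powr (-\<alpha>)) at_top" if u: "0 < u" for u
  proof (rule Lim_transform_eventually)
    have "filterlim (\<lambda>x. u * x) at_top at_top"
      using u by (intro filterlim_tendsto_pos_mult_at_top[OF tendsto_const] filterlim_ident)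
    hence "((\<lambda>x. u powr (-\<alpha>) * (((u * x) powr \<alpha> * F (u * x)) / (x powr \<alpha> * F x))) \<longlongrightarrow>
        u powr (-\<alpha>) * (L / L)) at_top"
      using L by (intro tendsto_intros lim' filterlim_compose[OF lim']) auto
    thus "((\<lambda>x. u powr (-\<alpha>) * (((u * x) powr \<alpha> * F (u * x)) / (x powr \<alpha> * F x))) \<longlongrightarrow>
        u powr (-\<alpha>)) at_top" using L by simp
    show "\<forall>\<^sub>F x in at_top. u powr (-\<alpha>) * (((u * x) powr \<alpha> * F (u * x)) / (x powr \<alpha> * F x)) = F (u * x) / F x"
      using eventually_gt_at_top[of 0]
    proof eventually_elim
      case (elim x)
      thus ?case using u by (simp add: powr_mult powr_minus field_simps)
    qed
  qed
  thus ?thesis using F_pos unfolding regularly_varying_tail_def F_def by simp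
qed

theorem theorem4p3:
  fixes M :: "'a measure" and \<Theta> :: "nat \<Rightarrow> 'a \<Rightarrow> real" and \<alpha> \<beta>\<^sub>0 :: real
  assumes "prob_space M"
    and "\<alpha> > 0"
    and "\<And>t. positive_rv M (\<Theta> t)"
    and "\<alpha> < 1 \<Longrightarrow> RW1 M \<alpha> \<Theta>"
    and "1 \<le> \<alpha> \<Longrightarrow> RW2 M \<alpha> \<Theta>"
    and "(\<lambda>t. \<integral>\<omega>. complex_of_real (\<Theta> t \<omega>) powr Complex \<alpha> \<beta>\<^sub>0 \<partial>M) sums 0"
  shows "\<exists>(N :: ('a \<times> (nat \<Rightarrow> real)) measure) \<pi> X.
           enlarged_prob_space N \<pi> M \<and>
           iid N X \<and>
           (\<forall>t. positive_rv N (X t)) \<and>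
           indep_sequences N X (\<lambda>t \<omega>. \<Theta> t (\<pi> \<omega>)) \<and>
           \<not> has_regularly_varying_tail N (X 0) \<and>
           (AE \<omega> in N. summable (\<lambda>t. \<Theta> t (\<pi> \<omega>) * X t \<omega>)) \<and>
           regularly_varying_tail N (\<lambda>\<omega>. \<Sum>t. \<Theta> t (\<pi> \<omega>) * X t \<omega>) (- \<alpha>)"
proof -
  interpret M: prob_space M by fact
  have \<Theta>: "\<Theta> t \<in> borel_measurable M" "AE \<theta> in M. 0 < \<Theta> t \<theta>" for t
    using assms(3)[of t] by (auto simp: positive_rv_def)
  obtain q where q: "1 \<le> q" "\<alpha> < q" and int: "\<And>t. integrable M (\<lambda>\<theta>. \<Theta> t \<theta> powr \<alpha>)"
    and summable_q: "summable (\<lambda>t. M.expectation (\<lambda>\<theta>. \<Theta> t \<theta> powr \<alpha>) powr (1 / q))"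
    by (rule M.moment_exponent_exists[of \<Theta> \<alpha>]) (use assms in auto)
  define e where "e t = M.expectation (\<lambda>\<theta>. \<Theta> t \<theta> powr \<alpha>)" for t
  have e: "0 < e t" for t
    unfolding e_def using \<Theta>(2) int by (rule M.expectation_powr_pos)
  from weights_exist[OF e q(1) summable_q[folded e_def]]
  obtain w where "\<forall>t. 0 < w t" "w sums 1"
    and summable_we: "summable (\<lambda>t. w t powr (1 - q) * e t)"
    by (elim exE conjE)
  hence w: "0 < w t" "w sums 1" for t by auto
  have summable_e: "summable e"
  proof (rule summable_comparison_test'[OF summable_we])
    fix t
    have "1 \<le> w t powr (1 - q)"
      using w q(1) by (rule weight_powr_ge_1)
    thus "norm (e t) \<le> w t powr (1 - q) * e t" using e[of t] by simp
  qed

  define b where "b = \<bar>\<beta>\<^sub>0\<bar>"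
  \<comment> \<open>At frequency 0 the complex moments are the positive numbers \<open>e t\<close>, whose sum is positive.\<close>
  have "\<beta>\<^sub>0 \<noteq> 0"
  proof
    assume "\<beta>\<^sub>0 = 0"
    hence "(\<integral>\<theta>. complex_of_real (\<Theta> t \<theta>) powr Complex \<alpha> \<beta>\<^sub>0 \<partial>M) = complex_of_real (e t)" for t
      using complex_moment_eq[OF \<Theta>, of t \<alpha> \<beta>\<^sub>0] by (simp add: e_def)
    hence "(\<lambda>t. complex_of_real (e t)) sums complex_of_real 0" using assms(6) by simp
    hence "e sums 0" by (simp only: sums_of_real_iff)
    moreover have "0 < suminf e" using summable_e e by (rule suminf_pos)
    ultimately show False by (simp add: sums_iff)
  qed
  then interpret lp: lp_parameters \<alpha> b
    using assms(2) by unfold_locales (auto simp: b_def)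
  interpret X: dominated_tail_law "lp_law \<alpha> b" \<alpha> "2 * \<alpha>" q "2 * \<alpha> / (q - \<alpha>)"
    using q by (rule lp.dominated_tail_law_lp_law)
  define N where "N = M \<Otimes>\<^sub>M X.P"
  define X where "X t z = snd z t" for t :: nat and z :: "'a \<times> (nat \<Rightarrow> real)"

  note sequences = product_space_sequences[OF assms(1) X.D.prob_space_axioms X.sets_D \<Theta>(1), folded N_def X_def]
  have "enlarged_prob_space N fst M" "iid N X" "indep_sequences N X (\<lambda>t z. \<Theta> t (fst z))"
    and X_law: "distr N borel (X t) = lp_law \<alpha> b" for t
    using sequences by (auto simp: X_def[abs_def])
  interpret N: prob_space N
    using \<open>enlarged_prob_space N fst M\<close> by (simp add: enlarged_prob_space_def)
  have X_meas [measurable]: "X t \<in> borel_measurable N" for t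
    using \<open>iid N X\<close> unfolding iid_def N.indep_vars_def by auto
  have [measurable]: "(\<lambda>z. \<Theta> t (fst z)) \<in> borel_measurable N" for t
    unfolding N_def using \<Theta>(1) by measurable

  have "positive_rv N (X t)" for t
    unfolding positive_rv_def
  proof
    have "AE y in distr N borel (X t). 0 < y" unfolding X_law by (rule X.AE_D_pos)
    thus "AE z in N. 0 < X t z" by (subst (asm) AE_distr_iff) auto
  qed simp

  have "\<not> has_regularly_varying_tail N (X 0)"
  proof
    assume "has_regularly_varying_tail N (X 0)"
    then obtain \<rho> where \<rho>: "\<forall>u>0. ((\<lambda>x. measure N {z \<in> space N. X 0 z > u * x} /
        measure N {z \<in> space N. X 0 z > x}) \<longlongrightarrow> u powr \<rho>) at_top"
      unfolding has_regularly_varying_tail_def regularly_varying_tail_def by blast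
    have "measure N {z \<in> space N. X 0 z > x} = measure (lp_law \<alpha> b) {x<..}" for x
      unfolding X_law[of 0, symmetric] by (subst measure_distr) (auto intro: arg_cong[where f = "measure N"])
    with \<rho> show False using lp.lp_law_tail_not_regularly_varying by simp
  qed

  note weights = assms(1,3) int w summable_we[unfolded e_def]
  have "AE z in N. summable (\<lambda>t. \<Theta> t (fst z) * X t z)"
    using X.AE_weighted_sum_summable[OF weights] unfolding N_def X_def by eventually_elim simp

  \<comment> \<open>Here the series of complex moments enters: it annihilates the oscillation at every scale \<open>x\<close>.\<close>
  have integral_profiles: "(\<Sum>t. \<integral>\<theta>. lp.lp_profile x (\<Theta> t \<theta>) \<partial>M) = suminf e / (1 + lp.a)" for x
  proof -
    let ?m = "\<lambda>t. \<integral>\<theta>. complex_of_real (\<Theta> t \<theta>) powr Complex \<alpha> \<beta>\<^sub>0 \<partial>M"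
    let ?c = "cis (- (\<beta>\<^sub>0 * ln x))"
    have "(\<lambda>t. Re (?c * ?m t)) sums Re (?c * 0)"
      by (intro bounded_linear.sums[OF bounded_linear_Re] sums_mult assms(6))
    hence "(\<lambda>t. (e t + lp.a * Re (?c * ?m t)) / (1 + lp.a)) sums ((suminf e + lp.a * Re (?c * 0)) / (1 + lp.a))"
      using summable_e by (intro sums_divide sums_add sums_mult summable_sums)
    moreover have "(\<integral>\<theta>. lp.lp_profile x (\<Theta> t \<theta>) \<partial>M) = (e t + lp.a * Re (?c * ?m t)) / (1 + lp.a)" for t
      unfolding e_def using \<Theta> int by (intro lp.integral_lp_profile) (auto simp: b_def)
    ultimately show ?thesis by (simp add: sums_iff)
  qed
  have "((\<lambda>x. x powr \<alpha> * measure N {z \<in> space N. x < (\<Sum>t. \<Theta> t (fst z) * X t z)} -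
      suminf e / (1 + lp.a)) \<longlongrightarrow> 0) at_top"
    using X.weighted_sum_tail_asymptotics[OF weights lp.lp_profile_bounds lp.borel_measurable_lp_profile
        lp.eventually_sum_tails_eq_sum_profiles]
    unfolding integral_profiles N_def X_def .
  hence "((\<lambda>x. x powr \<alpha> * measure N {z \<in> space N. x < (\<Sum>t. \<Theta> t (fst z) * X t z)}) \<longlongrightarrow>
      suminf e / (1 + lp.a)) at_top"
    by (rule LIM_zero_cancel)
  moreover have "0 < suminf e / (1 + lp.a)"
    using suminf_pos[OF summable_e e] lp.amplitude_bounds(1) by simp
  moreover have "(\<lambda>z. \<Sum>t. \<Theta> t (fst z) * X t z) \<in> borel_measurable N"
    by measurable
  ultimately have "regularly_varying_tail N (\<lambda>z. \<Sum>t. \<Theta> t (fst z) * X t z) (-\<alpha>)"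
    by (intro regularly_varying_tail_of_power_limit N.prob_space_axioms)
  show ?thesis
    by (intro exI[of _ N] exI[of _ fst] exI[of _ X] conjI allI) fact+
qed

end
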